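(* Let $f$ satisfy the $(2r,4r)$-restricted strong convexity and smoothness properties with parameter $\delta\in[0,1)$. Let $\mu,\alpha,\beta,\gamma\ge0$, write $N:=\|(\nabla f(\mathbf{X}^* ))_{\max(r)}\|_F$, and define $$\mathcal{R}_3'=\{\mathbf{Y}\in\mathbb{R}^{p\times r}_*:\|\overline{\mathrm{grad}\,H([\mathbf{Y}])}\|_F>\alpha\mu\sigma_r^3(\mathbf{Y}^* )/(4\kappa^* ),\ \|\mathbf{Y}\|\le\beta\|\mathbf{Y}^*\|,\ \|\mathbf{Y}\mathbf{Y}^\top\|_F\le\gamma\|\mathbf{Y}^*\mathbf{Y}^{*\top}\|_F\},$$ $$\mathcal{R}_3''=\{\mathbf{Y}\in\mathbb{R}^{p\times r}_*:\|\mathbf{Y}\|>\beta\|\mathbf{Y}^*\|,\ \|\mathbf{Y}\mathbf{Y}^\top\|_F\le\gamma\|\mathbf{Y}^*\mathbf{Y}^{*\top}\|_F\},\qquad\mathcal{R}_3'''=\{\mathbf{Y}\in\mathbb{R}^{p\times r}_*:\|\mathbf{Y}\mathbf{Y}^\top\|_F>\gamma\|\mathbf{Y}^*\mathbf{Y}^{*\top}\|_F\}.$$ (i) For every $\mathbf{Y}\in\mathcal{R}_3'$: $\|\overline{\mathrm{grad}\,h([\mathbf{Y}])}\|_F\ge\alpha\mu\sigma_r^3(\mathbf{Y}^* )/(4\kappa^* )-\big(2\delta\beta(1+\gamma)\|\mathbf{Y}^*\|\|\mathbf{Y}^*\mathbf{Y}^{*\top}\|_F+2\beta\|\mathbf{Y}^*\|N\big)$.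 (ii) For every $\mathbf{Y}\in\mathcal{R}_3''$: $\|\overline{\mathrm{grad}\,h([\mathbf{Y}])}\|_F>2(\beta^3-\beta)\|\mathbf{Y}^*\|^3-\big(2\delta(1+\gamma)\|\mathbf{Y}\|\|\mathbf{Y}^*\mathbf{Y}^{*\top}\|_F+2\|\mathbf{Y}\|N\big)$. (iii) For every $\mathbf{Y}\in\mathcal{R}_3'''$: $\|\overline{\mathrm{grad}\,h([\mathbf{Y}])}\|_F>\big(2(\gamma-1)-2\delta(\gamma+1)\big)\gamma^{1/2}\|\mathbf{Y}^*\mathbf{Y}^{*\top}\|_F^{3/2}/\sqrt r-2\gamma^{1/2}\|\mathbf{Y}^*\mathbf{Y}^{*\top}\|_F^{1/2}N/\sqrt r$. In particular, if $\beta>1$, $\gamma>1$, $\delta\le\delta_{\min}$ and $N\le\Psi$, where $$\delta_{\min}=\min\Big\{\frac{\alpha\mu}{32\kappa^{*2}\beta(1+\gamma)}\frac{\sigma_r^2(\mathbf{Y}^* )}{\|\mathbf{Y}^*\mathbf{Y}^{*\top}\|_F},\ \frac{\beta^2-1}{4(1+\gamma)}\frac{\|\mathbf{Y}^*\|^2}{\|\mathbf{Y}^*\mathbf{Y}^{*\top}\|_F},\ \frac{\gamma-1}{4(\gamma+1)}\Big\},$$ $$\Psi=\min\Big\{\frac{\alpha\mu}{32\kappa^{*2}\beta}\sigma_r^2(\mathbf{Y}^* ),\ \frac{\beta^2-1}{4}\|\mathbf{Y}^*\|^2,\ \frac{\gamma-1}{4}\|\mathbf{Y}^*\mathbf{Y}^{*\top}\|_F\Big\},$$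 then the gradient norm $\|\overline{\mathrm{grad}\,h([\mathbf{Y}])}\|_F$ in the regions $\mathcal{R}_3',\mathcal{R}_3'',\mathcal{R}_3'''$ is lower bounded by strictly positive quantities, given as follows: $$\|\overline{\mathrm{grad}\,h([\mathbf{Y}])}\|_F>\alpha\mu\sigma_r^3(\mathbf{Y}^* )/(8\kappa^* )\ \text{ for }\mathbf{Y}\in\mathcal{R}_3',$$ $$\|\overline{\mathrm{grad}\,h([\mathbf{Y}])}\|_F>(\beta^3-\beta)\|\mathbf{Y}^*\|^3\ \text{ for }\mathbf{Y}\in\mathcal{R}_3'',$$ $$\|\overline{\mathrm{grad}\,h([\mathbf{Y}])}\|_F>(\gamma-1)\gamma^{1/2}\|\mathbf{Y}^*\mathbf{Y}^{*\top}\|_F^{3/2}/\sqrt r\ \text{ for }\mathbf{Y}\in\mathcal{R}_3'''.$$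
   Context: Let $0<r\le p$ be integers. $\|\cdot\|$ and $\|\cdot\|_F$ are the spectral and Frobenius norms, $\sigma_i(\cdot)$ is the $i$-th largest singular value, and $\mathbf{A}_{\max(r)}$ is the best rank-$r$ approximation of $\mathbf{A}$ in Frobenius norm (truncated SVD). $\mathbb{R}^{p\times r}_*$ is the set of real $p\times r$ matrices of full column rank and $\mathbb{O}_r$ is the orthogonal group. Quotient geometry: $\mathcal{M}:=\mathbb{R}^{p\times r}_*/\mathbb{O}_r$ has points $[\mathbf{Y}]=\{\mathbf{Y}\mathbf{O}:\mathbf{O}\in\mathbb{O}_r\}$ and carries the Riemannian metric induced from $\bar g_{\mathbf{Y}}(\eta,\theta)=\mathrm{tr}(\eta^\top\theta)$; tangent vectors at $[\mathbf{Y}]$ are represented by horizontal lifts in $\{\theta\in\mathbb{R}^{p\times r}:\mathbf{Y}^\top\theta\text{ symmetric}\}$. Objective: $f:\mathbb{R}^{p\times p}\to\mathbb{R}$ is twice continuously differentiable with $f(\mathbf{X})=f(\mathbf{X}^\top)$, with Euclidean gradient $\nabla f$ and Hessian bilinear form $\nabla^2f(\mathbf{X})[\cdot,\cdot]$. $f$ satisfies the $(2r,4r)$-restricted strong convexity and smoothness properties with parameter $0\le\delta<1$ if $(1-\delta)\|\mathbf{G}\|_F^2\le\nabla^2f(\mathbf{X})[\mathbf{G},\mathbf{G}]\le(1+\delta)\|\mathbf{G}\|_F^2$ for all $\mathbf{X},\mathbf{G}\in\mathbb{R}^{p\times p}$ with $\mathrm{rank}(\mathbf{X})\le2r$, $\mathrm{rank}(\mathbf{G})\le4r$.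 Define $h([\mathbf{Y}])=f(\mathbf{Y}\mathbf{Y}^\top)$ on $\mathcal{M}$; the horizontal lift of its Riemannian gradient is $\overline{\mathrm{grad}\,h([\mathbf{Y}])}=2\nabla f(\mathbf{Y}\mathbf{Y}^\top)\mathbf{Y}$. Target: $\mathbf{X}^*\in\mathbb{R}^{p\times p}$ is a fixed symmetric positive semidefinite matrix of rank $r$ with reduced eigendecomposition $\mathbf{U}^*\boldsymbol{\Sigma}^*\mathbf{U}^{*\top}$; $\mathbf{Y}^*=\mathbf{U}^*\boldsymbol{\Sigma}^{*1/2}$, $\kappa^*=\sigma_1(\mathbf{Y}^* )/\sigma_r(\mathbf{Y}^* )$. Also $H([\mathbf{Y}])=\frac12\|\mathbf{Y}\mathbf{Y}^\top-\mathbf{X}^*\|_F^2$ on $\mathcal{M}$, with lifted Riemannian gradient $\overline{\mathrm{grad}\,H([\mathbf{Y}])}=2(\mathbf{Y}\mathbf{Y}^\top-\mathbf{X}^* )\mathbf{Y}$.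
   Formalization: In (ii) the strict ">" is relaxed to "≥" when β=δ=N=0, and in (iii) when γ=0, where the strict claims can read 0>0 (f=½‖X−X*‖², Y=Y* ); strict positivity of αμσ_r³/(8κ* ) is claimed only for α,μ>0. *)

theory Defs
  imports "HOL-Analysis.Analysis"
begin

text \<open>
  Matrices of size \<open>p\<close> by \<open>r\<close> are elements of \<open>real^'r^'p\<close> with \<open>p = CARD('p)\<close> and \<open>r = CARD('r)\<close>.
  The type's own \<open>norm\<close> is the Frobenius norm and \<open>\<bullet>\<close> is the Frobenius inner product.
\<close>

definition spectral_norm :: "real^'n^'m \<Rightarrow> real" where
  "spectral_norm A = onorm (\<lambda>x. A *v x)"

definition diag_mat :: "real^'n \<Rightarrow> real^'n^'n" where
  "diag_mat s = (\<chi> i j. if i = j then s $ i else 0)"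

text \<open>
  Distinct singular values, with multiplicities read off the eigenspaces of \<open>transpose A ** A\<close>.
  For wide \<open>A\<close> this pads the usual list with zeros; only tall matrices are used below.
\<close>

definition singular_values :: "real^'n^'m \<Rightarrow> real set" where
  "singular_values A =
     {s. 0 \<le> s \<and> (\<exists>x. x \<noteq> 0 \<and> (transpose A ** A) *v x = s\<^sup>2 *\<^sub>R x)}"

definition sv_mult :: "real^'n^'m \<Rightarrow> real \<Rightarrow> nat" where
  "sv_mult A s = dim {x. (transpose A ** A) *v x = s\<^sup>2 *\<^sub>R x}"

text \<open>
  The \<open>i\<close>-th largest singular value (counting from 1, with multiplicity): the largest singular
  value \<open>s\<close> such that at least \<open>i\<close> singular values, counted with multiplicity, are \<open>\<ge> s\<close>.
\<close>

definition sing_val :: "nat \<Rightarrow> real^'n^'m \<Rightarrow> real" where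
  "sing_val i A =
     Max {s \<in> singular_values A. i \<le> (\<Sum>t\<in>{t \<in> singular_values A. s \<le> t}. sv_mult A t)}"

text \<open>
  Best rank-\<open>k\<close> approximation in Frobenius norm. It need not be unique when singular values
  coincide, but all best approximations have the same Frobenius norm.
\<close>

definition is_best_rank_approx :: "nat \<Rightarrow> real^'n^'m \<Rightarrow> real^'n^'m \<Rightarrow> bool" where
  "is_best_rank_approx k A B \<longleftrightarrow>
     rank B \<le> k \<and> (\<forall>C. rank C \<le> k \<longrightarrow> norm (A - B) \<le> norm (A - C))"

definition best_rank_approx :: "nat \<Rightarrow> real^'n^'m \<Rightarrow> real^'n^'m" where
  "best_rank_approx k A = (SOME B. is_best_rank_approx k A B)"

definition psd :: "real^'n^'n \<Rightarrow> bool" where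
  "psd A \<longleftrightarrow> transpose A = A \<and> (\<forall>x. 0 \<le> x \<bullet> (A *v x))"

definition reduced_eigendecomp :: "real^'p^'p \<Rightarrow> real^'r^'p \<Rightarrow> real^'r \<Rightarrow> bool" where
  "reduced_eigendecomp X U s \<longleftrightarrow>
     transpose U ** U = mat 1 \<and> (\<forall>i. s $ i \<noteq> 0) \<and> X = U ** diag_mat s ** transpose U"

definition euclidean_grad :: "('a::real_inner \<Rightarrow> real) \<Rightarrow> 'a \<Rightarrow> 'a" where
  "euclidean_grad f x = (THE g. GDERIV f x :> g)"

definition hess :: "('a::real_inner \<Rightarrow> real) \<Rightarrow> 'a \<Rightarrow> 'a \<Rightarrow> 'a \<Rightarrow> real" where
  "hess f x u v = frechet_derivative (euclidean_grad f) (at x) u \<bullet> v"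

text \<open>In finite dimension, continuity of all the maps \<open>\<lambda>x. hess f x u v\<close> is continuity of the Hessian.\<close>

definition twice_cont_differentiable :: "('a::euclidean_space \<Rightarrow> real) \<Rightarrow> bool" where
  "twice_cont_differentiable f \<longleftrightarrow>
     (\<forall>x. f differentiable (at x)) \<and>
     (\<forall>x. euclidean_grad f differentiable (at x)) \<and>
     (\<forall>u v. continuous_on UNIV (\<lambda>x. hess f x u v))"

definition restricted_strong_convex_smooth ::
    "nat \<Rightarrow> nat \<Rightarrow> real \<Rightarrow> (real^'p^'p \<Rightarrow> real) \<Rightarrow> bool" where
  "restricted_strong_convex_smooth k l \<delta> f \<longleftrightarrow>
     (\<forall>X G. rank X \<le> k \<and> rank G \<le> l \<longrightarrow>
        (1 - \<delta>) * (norm G)\<^sup>2 \<le> hess f X G G \<and> hess f X G G \<le> (1 + \<delta>) * (norm G)\<^sup>2)"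

definition full_col_rank :: "(real^'r^'p) set" where
  "full_col_rank = {Y. rank Y = CARD('r)}"

text \<open>The point \<open>[Y]\<close> of the quotient by the orthogonal group.\<close>

definition orbit :: "real^'r^'p \<Rightarrow> (real^'r^'p) set" where
  "orbit Y = {Y ** Q | Q. orthogonal_matrix Q}"

text \<open>
  The function \<open>[Y] \<mapsto> f (Y ** transpose Y)\<close> on orbits; the value does not depend on the
  representative, so the image below is a singleton.
\<close>

definition quotient_fun :: "(real^'p^'p \<Rightarrow> real) \<Rightarrow> (real^'r^'p) set \<Rightarrow> real" where
  "quotient_fun f C = the_elem ((\<lambda>Y. f (Y ** transpose Y)) ` C)"

definition horizontal :: "real^'r^'p \<Rightarrow> (real^'r^'p) set" where
  "horizontal Y = {\<theta>. transpose (transpose Y ** \<theta>) = transpose Y ** \<theta>}"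

definition metric :: "real^'r^'p \<Rightarrow> real^'r^'p \<Rightarrow> real" where
  "metric \<eta> \<theta> = trace (transpose \<eta> ** \<theta>)"

text \<open>
  Horizontal lift at \<open>Y\<close> of the Riemannian gradient at \<open>[Y]\<close> of a function \<open>h\<close> on the quotient:
  the horizontal vector representing the differential of \<open>h\<close>. The differential at \<open>[Y]\<close> in the
  direction with horizontal lift \<open>\<theta>\<close> is the derivative of \<open>h \<circ> orbit\<close> at \<open>Y\<close> in direction \<open>\<theta>\<close>.
\<close>

definition lifted_grad :: "((real^'r^'p) set \<Rightarrow> real) \<Rightarrow> real^'r^'p \<Rightarrow> real^'r^'p" where
  "lifted_grad h Y = (THE \<xi>. \<xi> \<in> horizontal Y \<and>
     (\<forall>\<theta>\<in>horizontal Y. metric \<xi> \<theta> = frechet_derivative (h \<circ> orbit) (at Y) \<theta>))"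

definition obj_h :: "(real^'p^'p \<Rightarrow> real) \<Rightarrow> (real^'r^'p) set \<Rightarrow> real" where
  "obj_h f = quotient_fun f"

definition obj_H :: "real^'p^'p \<Rightarrow> (real^'r^'p) set \<Rightarrow> real" where
  "obj_H Xs = quotient_fun (\<lambda>X. (norm (X - Xs))\<^sup>2 / 2)"

definition cond_num :: "real^'r^'p \<Rightarrow> real" where
  "cond_num Y = sing_val 1 Y / sing_val CARD('r) Y"

definition region1 :: "real^'p^'p \<Rightarrow> real^'r^'p \<Rightarrow> real \<Rightarrow> real \<Rightarrow> real \<Rightarrow> real \<Rightarrow> (real^'r^'p) set" where
  "region1 Xs Ys \<mu> \<alpha> \<beta> \<gamma> = {Y \<in> full_col_rank.
     norm (lifted_grad (obj_H Xs) Y) > \<alpha> * \<mu> * (sing_val CARD('r) Ys)^3 / (4 * cond_num Ys) \<and>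
     spectral_norm Y \<le> \<beta> * spectral_norm Ys \<and>
     norm (Y ** transpose Y) \<le> \<gamma> * norm (Ys ** transpose Ys)}"

definition region2 :: "real^'r^'p \<Rightarrow> real \<Rightarrow> real \<Rightarrow> (real^'r^'p) set" where
  "region2 Ys \<beta> \<gamma> = {Y \<in> full_col_rank.
     spectral_norm Y > \<beta> * spectral_norm Ys \<and>
     norm (Y ** transpose Y) \<le> \<gamma> * norm (Ys ** transpose Ys)}"

definition region3 :: "real^'r^'p \<Rightarrow> real \<Rightarrow> (real^'r^'p) set" where
  "region3 Ys \<gamma> = {Y \<in> full_col_rank.
     norm (Y ** transpose Y) > \<gamma> * norm (Ys ** transpose Ys)}"

end

theory Submission
  imports Defs
begin

text \<open>
  With \<open>X = Y ** transpose Y\<close> the lifted gradients are \<open>2 *\<^sub>R (euclidean_grad f X ** Y)\<close> and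
  \<open>2 *\<^sub>R ((X - Xs) ** Y)\<close>. Tested against a matrix \<open>G\<close> of rank at most \<open>r\<close>, the restricted Hessian
  bounds (polarised, then integrated from \<open>Xs\<close> to \<open>X\<close>) make \<open>euclidean_grad f X - euclidean_grad f Xs\<close>
  differ from \<open>X - Xs\<close> by at most \<open>\<delta> * norm (X - Xs) * norm G\<close>, while \<open>euclidean_grad f Xs\<close> contributes
  at most \<open>N * norm G\<close>. Choosing \<open>G = W ** transpose Y\<close>, where \<open>W\<close> is half the difference of the two
  lifted gradients, bounds the gradient of \<open>h\<close> below by that of \<open>H\<close>, which in turn dominates
  \<open>2 * y * (y\<^sup>2 - (spectral_norm Ys)\<^sup>2)\<close> for \<open>y = spectral_norm Y\<close>. In the third region one takes
  \<open>G = X\<close>, that is, one tests the gradient against \<open>Y\<close> itself.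
\<close>

section \<open>Matrices and the spectral norm\<close>

lemma inner_matrix_mult_left:
  fixes A :: "real^'n^'m" and B :: "real^'k^'n"
  shows "(A ** B) \<bullet> C = A \<bullet> (C ** transpose B)"
proof -
  have "(A ** B) \<bullet> C = (\<Sum>i\<in>UNIV. \<Sum>j\<in>UNIV. \<Sum>k\<in>UNIV. A$i$k * B$k$j * C$i$j)"
    by (simp add: inner_vec_def matrix_matrix_mult_def sum_distrib_right)
  also have "\<dots> = (\<Sum>i\<in>UNIV. \<Sum>k\<in>UNIV. \<Sum>j\<in>UNIV. A$i$k * B$k$j * C$i$j)"
    by (intro sum.cong refl sum.swap)
  also have "\<dots> = A \<bullet> (C ** transpose B)"
    by (simp add: inner_vec_def matrix_matrix_mult_def sum_distrib_left transpose_def ac_simps)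
  finally show ?thesis .
qed

lemma inner_transpose: "transpose A \<bullet> transpose B = A \<bullet> (B :: real^'n^'m)"
  by (simp add: inner_vec_def transpose_def) (rule sum.swap)

lemma inner_matrix_mult_right:
  fixes A :: "real^'n^'m" and B :: "real^'k^'n"
  shows "(A ** B) \<bullet> C = B \<bullet> (transpose A ** C)"
proof -
  have "(A ** B) \<bullet> C = (transpose B ** transpose A) \<bullet> transpose C"
    by (simp only: inner_transpose flip: matrix_transpose_mul)
  also have "\<dots> = transpose B \<bullet> transpose (transpose A ** C)"
    by (simp only: inner_matrix_mult_left matrix_transpose_mul)
  finally show ?thesis
    by (simp only: inner_transpose)
qed

lemma norm_transpose: "norm (transpose A) = norm (A :: real^'n^'m)"
  by (simp add: norm_eq_sqrt_inner inner_transpose)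

lemma metric_eq_inner: "metric \<eta> \<theta> = \<eta> \<bullet> \<theta>"
  by (simp add: metric_def trace_def matrix_matrix_mult_def transpose_def inner_vec_def) (rule sum.swap)

lemma bounded_bilinear_matrix_mult:
  "bounded_bilinear ((**) :: real^'n^'m \<Rightarrow> real^'k^'n \<Rightarrow> real^'k^'m)"
  unfolding bilinear_conv_bounded_bilinear[symmetric] bilinear_def
  by (auto intro!: linearI simp: matrix_matrix_mult_def vec_eq_iff sum.distrib
      sum_distrib_left algebra_simps)

lemma bounded_linear_transpose: "bounded_linear (transpose :: real^'n^'m \<Rightarrow> real^'m^'n)"
  unfolding linear_conv_bounded_linear[symmetric]
  by (auto intro!: linearI simp: transpose_def vec_eq_iff)

lemmas continuous_on_matrix_mult =
  bounded_bilinear.continuous_on[OF bounded_bilinear_matrix_mult]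
lemmas continuous_on_transpose =
  bounded_linear.continuous_on[OF bounded_linear_transpose]

lemma transpose_diff: "transpose (A - B) = transpose A - transpose (B :: real^'n^'m)"
  by (simp add: transpose_def vec_eq_iff)

lemma matrix_diff_rdistrib: "(A - B) ** C = A ** C - B ** (C :: real^'k^'n)" for A :: "real^'n^'m"
  by (rule bounded_bilinear.diff_left[OF bounded_bilinear_matrix_mult])

lemma matrix_diff_ldistrib: "A ** (B - C) = A ** B - A ** (C :: real^'k^'n)" for A :: "real^'n^'m"
  by (rule bounded_bilinear.diff_right[OF bounded_bilinear_matrix_mult])

section \<open>Rank of sums, multiples and differences\<close>

lemma rank_add_le: "rank (A + B) \<le> rank A + rank (B :: real^'n^'m)"
proof -
  let ?S = "range ((*v) A)" and ?T = "range ((*v) B)"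
  have sub: "subspace ?S" "subspace ?T"
    by (simp_all add: linear_subspace_image subspace_UNIV)
  have "rank (A + B) \<le> dim {x + y |x y. x \<in> ?S \<and> y \<in> ?T}"
    unfolding rank_dim_range by (rule dim_subset) (auto simp: matrix_vector_mult_add_rdistrib)
  also have "\<dots> \<le> rank A + rank B"
    using dim_sums_Int[OF sub] unfolding rank_dim_range by linarith
  finally show ?thesis .
qed

lemma rank_scaleR_le: "rank (c *\<^sub>R A) \<le> rank (A :: real^'n^'m)"
proof -
  have "c *\<^sub>R A = A ** (c *\<^sub>R mat 1)"
    by (metis matrix_mul_rid matrix_scalar_ac scalar_matrix_assoc)
  then show ?thesis
    by (simp add: rank_mul_le_left)
qed

lemma rank_diff_le: "rank (A - B) \<le> rank A + rank (B :: real^'n^'m)"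
  using rank_add_le[of A "-1 *\<^sub>R B"] rank_scaleR_le[of "-1" B] by simp

section \<open>The spectral norm and its comparison with the Frobenius norm\<close>

lemma spectral_norm_bound: "norm (A *v x) \<le> spectral_norm A * norm x"
  for A :: "real^'n^'m"
  unfolding spectral_norm_def by (rule onorm) simp

lemma spectral_norm_le: "(\<And>x. norm (A *v x) \<le> b * norm x) \<Longrightarrow> spectral_norm A \<le> b"
  for A :: "real^'n^'m"
  unfolding spectral_norm_def by (rule onorm_le)

lemma spectral_norm_nonneg: "0 \<le> spectral_norm A" for A :: "real^'n^'m"
  unfolding spectral_norm_def by (rule onorm_pos_le) simp

lemma spectral_norm_eq_0_iff: "spectral_norm A = 0 \<longleftrightarrow> A = 0" for A :: "real^'n^'m"
  unfolding spectral_norm_def by (subst onorm_eq_0) (auto simp: matrix_eq)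

lemma spectral_norm_le_norm: "spectral_norm A \<le> norm A" for A :: "real^'n^'m"
proof (rule spectral_norm_le)
  fix x
  have "norm (A *v x) \<le> L2_set (\<lambda>i. norm (A $ i) * norm x) UNIV"
    unfolding norm_vec_def[of "A *v x"]
    by (rule L2_set_mono) (simp_all add: matrix_vector_mul_component Cauchy_Schwarz_ineq2)
  also have "\<dots> = norm A * norm x"
    unfolding norm_vec_def[of A] by (simp add: L2_set_left_distrib)
  finally show "norm (A *v x) \<le> norm A * norm x" .
qed

text \<open>Row \<open>i\<close> of the product is \<open>Y\<close> applied to row \<open>i\<close>
  of \<open>Z\<close>, so the bound holds row by row.\<close>

lemma norm_matrix_mult_transpose_le: "norm (Z ** transpose Y) \<le> spectral_norm Y * norm Z"
  for Y :: "real^'n^'m" and Z :: "real^'n^'k"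
proof -
  have row: "(Z ** transpose Y) $ i = Y *v (Z $ i)" for i
    by (simp add: vec_eq_iff matrix_matrix_mult_def matrix_vector_mult_def transpose_def mult.commute)
  have "norm (Z ** transpose Y) \<le> L2_set (\<lambda>i. spectral_norm Y * norm (Z $ i)) UNIV"
    unfolding norm_vec_def[of "Z ** transpose Y"]
    by (rule L2_set_mono) (simp_all add: row spectral_norm_bound)
  also have "\<dots> = spectral_norm Y * norm Z"
    unfolding norm_vec_def[of Z] by (simp add: L2_set_right_distrib spectral_norm_nonneg)
  finally show ?thesis .
qed

lemma spectral_norm_mult_le: "spectral_norm (A ** B) \<le> spectral_norm A * spectral_norm B"
  for A :: "real^'n^'m" and B :: "real^'k^'n"
proof (rule spectral_norm_le)
  fix x
  have "norm ((A ** B) *v x) \<le> spectral_norm A * norm (B *v x)"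
    by (metis matrix_vector_mul_assoc spectral_norm_bound)
  also have "\<dots> \<le> spectral_norm A * (spectral_norm B * norm x)"
    by (intro mult_left_mono spectral_norm_bound spectral_norm_nonneg)
  finally show "norm ((A ** B) *v x) \<le> spectral_norm A * spectral_norm B * norm x"
    by simp
qed

lemma norm_matrix_vector_sq: "(norm (A *v x))\<^sup>2 = x \<bullet> ((transpose A ** A) *v x)"
  for A :: "real^'n^'m"
  using dot_lmul_matrix[of x "transpose A" "A *v x"]
  by (simp add: matrix_vector_mul_assoc power2_norm_eq_inner)

text \<open>Cauchy-Schwarz for \<open>x \<bullet> ((transpose A ** A) *v x)\<close>, which is the
  square of \<open>norm (A *v x)\<close>.\<close>

lemma spectral_norm_sq_le: "(spectral_norm A)\<^sup>2 \<le> spectral_norm (transpose A ** A)"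
  for A :: "real^'n^'m"
proof -
  let ?c = "spectral_norm (transpose A ** A)"
  have "norm (A *v x) \<le> sqrt ?c * norm x" for x
  proof -
    have "(norm (A *v x))\<^sup>2 \<le> norm x * norm ((transpose A ** A) *v x)"
      unfolding norm_matrix_vector_sq by (rule norm_cauchy_schwarz)
    also have "\<dots> \<le> norm x * (?c * norm x)"
      by (intro mult_left_mono spectral_norm_bound norm_ge_zero)
    also have "\<dots> = (sqrt ?c * norm x)\<^sup>2"
      by (simp add: power_mult_distrib spectral_norm_nonneg) (simp add: power2_eq_square)
    finally show ?thesis
      by (rule power2_le_imp_le) (simp add: spectral_norm_nonneg)
  qed
  then have "spectral_norm A \<le> sqrt ?c"
    by (rule spectral_norm_le)
  then have "(spectral_norm A)\<^sup>2 \<le> (sqrt ?c)\<^sup>2"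
    by (intro power_mono spectral_norm_nonneg)
  then show ?thesis
    by (simp add: spectral_norm_nonneg)
qed

text \<open>Submultiplicativity bounds the norm of the Gram matrix from above; one factor
  \<open>spectral_norm A\<close> then cancels.\<close>

lemma spectral_norm_le_transpose: "spectral_norm A \<le> spectral_norm (transpose A)"
  for A :: "real^'n^'m"
proof (cases "A = 0")
  case False
  then have "0 < spectral_norm A"
    using spectral_norm_nonneg[of A] spectral_norm_eq_0_iff[of A] by linarith
  moreover have "(spectral_norm A)\<^sup>2 \<le> spectral_norm (transpose A) * spectral_norm A"
    using spectral_norm_sq_le spectral_norm_mult_le order_trans by blast
  ultimately show ?thesis
    by (simp add: power2_eq_square)
next
  case True
  have "spectral_norm A = 0"
    using True by (simp add: spectral_norm_eq_0_iff)
  then show ?thesis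
    by (simp add: spectral_norm_nonneg)
qed

lemma spectral_norm_transpose: "spectral_norm (transpose A) = spectral_norm A"
  for A :: "real^'n^'m"
  using spectral_norm_le_transpose[of A] spectral_norm_le_transpose[of "transpose A"] by simp

lemma spectral_norm_triangle: "spectral_norm (A + B) \<le> spectral_norm A + spectral_norm B"
  for A B :: "real^'n^'m"
  unfolding spectral_norm_def matrix_vector_mult_add_rdistrib by (rule onorm_triangle) simp_all

lemma spectral_norm_gram: "spectral_norm (transpose A ** A) = (spectral_norm A)\<^sup>2"
  for A :: "real^'n^'m"
  using spectral_norm_sq_le[of A] spectral_norm_mult_le[of "transpose A" A]
  by (simp add: spectral_norm_transpose power2_eq_square)

text \<open>The Gram identity, applied to \<open>Y\<close> and to \<open>transpose Y ** Y\<close>,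
  expresses the fourth power of \<open>spectral_norm Y\<close> as the norm of
  \<open>transpose Y ** (Y ** transpose Y ** Y)\<close>; one factor \<open>spectral_norm Y\<close>
  cancels.\<close>

lemma spectral_norm_cube_le: "(spectral_norm Y)^3 \<le> spectral_norm (Y ** transpose Y ** Y)"
  for Y :: "real^'r^'p"
proof (cases "spectral_norm Y = 0")
  case False
  then have pos: "0 < spectral_norm Y"
    using spectral_norm_nonneg[of Y] by linarith
  have "spectral_norm Y * (spectral_norm Y)^3 = (spectral_norm (transpose Y ** Y))\<^sup>2"
    by (simp add: spectral_norm_gram power2_eq_square power3_eq_cube)
  also have "\<dots> = spectral_norm (transpose Y ** (Y ** transpose Y ** Y))"
    by (simp add: matrix_transpose_mul matrix_mul_assoc flip: spectral_norm_gram)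
  also have "\<dots> \<le> spectral_norm Y * spectral_norm (Y ** transpose Y ** Y)"
    using spectral_norm_mult_le[of "transpose Y"] by (simp add: spectral_norm_transpose)
  finally show ?thesis
    using pos by simp
qed (simp add: spectral_norm_nonneg)

text \<open>Each of the \<open>CARD('r)\<close> columns has squared norm at most
  \<open>(spectral_norm Y)\<^sup>2\<close>, hence at most \<open>norm (Y ** transpose Y)\<close>.
  This is the source of the divisor \<open>sqrt (real CARD('r))\<close> in the third region.\<close>

lemma norm_sq_le_rank_norm_gram: "(norm Y)\<^sup>2 \<le> CARD('r) * norm (Y ** transpose Y)"
  for Y :: "real^'r^'p"
proof -
  have "(spectral_norm Y)\<^sup>2 = spectral_norm (Y ** transpose Y)"
    using spectral_norm_gram[of "transpose Y"] by (simp add: spectral_norm_transpose)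
  also have "\<dots> \<le> norm (Y ** transpose Y)"
    by (rule spectral_norm_le_norm)
  finally have sq: "(spectral_norm Y)\<^sup>2 \<le> norm (Y ** transpose Y)" .
  have "(norm Y)\<^sup>2 = (norm (transpose Y))\<^sup>2"
    by (simp add: norm_transpose)
  also have "\<dots> = (\<Sum>i\<in>UNIV. (norm (Y *v axis i 1))\<^sup>2)"
    by (simp add: norm_vec_def[of "transpose Y"] L2_set_def sum_nonneg matrix_vector_mult_basis)
      (simp add: transpose_def column_def)
  also have "\<dots> \<le> (\<Sum>i\<in>(UNIV :: 'r set). norm (Y ** transpose Y))"
  proof (rule sum_mono)
    fix i :: 'r
    have "(norm (Y *v axis i 1))\<^sup>2 \<le> (spectral_norm Y * norm (axis i (1 :: real)))\<^sup>2"
      by (intro power_mono spectral_norm_bound norm_ge_zero)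
    with sq show "(norm (Y *v axis i 1))\<^sup>2 \<le> norm (Y ** transpose Y)"
      by (simp add: norm_axis_1)
  qed
  finally show ?thesis
    by simp
qed

section \<open>Best low-rank approximation\<close>

text \<open>A basis of \<open>V\<close> extends to a basis of the whole space, of which
  \<open>n\<close> vectors containing the first basis are kept.\<close>

lemma subspace_extend_dim:
  fixes V :: "'a::euclidean_space set"
  assumes "subspace V" "dim V \<le> n" "n \<le> DIM('a)"
  obtains T where "subspace T" "V \<subseteq> T" "dim T = n"
proof -
  obtain B where B: "B \<subseteq> V" "independent B" "V \<subseteq> span B" "card B = dim V"
    by (rule basis_exists)
  obtain B' where B': "B \<subseteq> B'" "independent B'" "UNIV \<subseteq> span B'"
    by (rule maximal_independent_subset_extend[OF subset_UNIV B(2)])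
  have "card B' = DIM('a)"
    using basis_card_eq_dim[of B' UNIV] B'(2,3) by simp
  then obtain C where C: "B \<subseteq> C" "C \<subseteq> B'" "card C = n"
    using exists_subset_between[of B n B'] B(4) B'(1) assms independent_imp_finite[OF B'(2)] by auto
  show thesis
  proof
    show "subspace (span C)"
      by simp
    show "V \<subseteq> span C"
      using B(3) C(1) span_mono by blast
    show "dim (span C) = n"
      using C B'(2) by (metis dim_span_eq_card_independent independent_mono)
  qed
qed

text \<open>The columns of \<open>Q\<close> form an orthonormal basis of a subspace containing the
  range of \<open>C\<close>, so \<open>Q ** transpose Q\<close> is an orthogonal projection fixing
  \<open>C\<close>. The type fixes the number of columns, which is why the range is first padded to
  dimension \<open>CARD('k)\<close>.\<close>

lemma rank_le_orthonormal_factor: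
  fixes C :: "real^'n^'m"
  assumes "rank C \<le> CARD('k)" "CARD('k) \<le> CARD('m)"
  obtains Q :: "real^'k^'m" where "transpose Q ** Q = mat 1" "Q ** transpose Q ** C = C"
proof -
  let ?V = "range ((*v) C)"
  obtain T where T: "subspace T" "?V \<subseteq> T" "dim T = CARD('k)"
    using subspace_extend_dim[of ?V "CARD('k)"] assms
    by (auto simp: rank_dim_range linear_subspace_image subspace_UNIV)
  obtain B where B: "pairwise orthogonal B" "\<And>x. x \<in> B \<Longrightarrow> norm x = 1" "independent B"
      "card B = dim T" "span B = T"
    using orthonormal_basis_subspace[OF T(1)] by metis
  have fin: "finite B"
    using B(3) by (rule independent_imp_finite)
  then obtain b :: "'k \<Rightarrow> real^'m" where b: "bij_betw b UNIV B"
    using B(4) T(3) finite_same_card_bij[of "UNIV :: 'k set" B] by auto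
  define Q :: "real^'k^'m" where "Q = (\<chi> i j. b j $ i)"
  have col: "column j Q = b j" for j
    by (simp add: Q_def column_def)
  have bB: "b i \<in> B" for i
    using b by (auto simp: bij_betw_def)
  have "b i \<bullet> b j = (if i = j then 1 else 0)" for i j
  proof (cases "i = j")
    case False
    then have "b i \<noteq> b j"
      using b by (auto simp: bij_betw_def inj_on_def)
    then show ?thesis
      using False B(1) bB by (simp add: pairwise_def orthogonal_def)
  qed (use B(2)[OF bB] in \<open>simp add: norm_eq_1\<close>)
  then have QQ: "transpose Q ** Q = mat 1"
    by (simp add: matrix_mult_transpose_dot_column col mat_def vec_eq_iff)
  have "(Q ** transpose Q ** C) *v x = C *v x" for x
  proof -
    let ?y = "C *v x"
    have "?y \<in> span B"
      using T(2) B(5) by auto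
    then have "(\<Sum>i\<in>B. (?y \<bullet> i) *\<^sub>R i) = ?y"
      by (intro orthonormal_basis_expand B fin) auto
    moreover have "(\<Sum>i\<in>B. (?y \<bullet> i) *\<^sub>R i) = (\<Sum>j\<in>UNIV. (?y \<bullet> b j) *\<^sub>R b j)"
      by (rule sum.reindex_bij_betw[OF b, symmetric])
    moreover have "(\<Sum>j\<in>UNIV. (y \<bullet> b j) *\<^sub>R b j) = Q *v (transpose Q *v y)" for y
    proof -
      have "(transpose Q *v y) $ j = y \<bullet> b j" for j
        by (simp add: Q_def transpose_def matrix_vector_mult_def inner_vec_def mult.commute)
      then show ?thesis
        by (simp only: matrix_mult_sum[of Q] col scalar_mult_eq_scaleR)
    qed
    ultimately show ?thesis
      by (simp add: matrix_vector_mul_assoc matrix_mul_assoc)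
  qed
  then have "Q ** transpose Q ** C = C"
    by (simp add: matrix_eq)
  with QQ show thesis
    by (rule that)
qed

text \<open>The trace of the Gram matrix is the squared Frobenius norm, so all these matrices lie on
  a sphere.\<close>

lemma compact_orthonormal_columns: "compact {Q :: real^'k^'m. transpose Q ** Q = mat 1}"
proof -
  have "closed {Q :: real^'k^'m. transpose Q ** Q = mat 1}"
    by (intro closed_Collect_eq continuous_on_matrix_mult continuous_on_transpose continuous_intros)
  moreover have "norm Q \<le> sqrt (CARD('k))" if "transpose Q ** Q = mat 1" for Q :: "real^'k^'m"
    using that metric_eq_inner[of Q Q] by (simp add: metric_def trace_I norm_eq_sqrt_inner)
  then have "bounded {Q :: real^'k^'m. transpose Q ** Q = mat 1}"
    by (auto simp: bounded_iff)
  ultimately show ?thesis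
    by (simp add: compact_eq_bounded_closed)
qed

text \<open>Pythagoras: the residual of the projection is orthogonal to every matrix of the form
  \<open>Q ** B\<close>, in particular to the projection of \<open>A\<close> minus
  \<open>C\<close>.\<close>

lemma norm_diff_projection_le:
  fixes A C :: "real^'n^'m" and Q :: "real^'k^'m"
  assumes QQ: "transpose Q ** Q = mat 1" and C: "Q ** transpose Q ** C = C"
  shows "norm (A - Q ** transpose Q ** A) \<le> norm (A - C)"
proof -
  let ?P = "Q ** transpose Q"
  have "transpose Q ** ?P = transpose Q"
    by (simp add: matrix_mul_assoc QQ)
  then have "transpose Q ** (A - ?P ** A) = 0"
    by (simp add: matrix_diff_ldistrib matrix_mul_assoc)
  then have "(Q ** (transpose Q ** (A - C))) \<bullet> (A - ?P ** A) = 0"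
    by (simp add: inner_matrix_mult_right[of Q])
  moreover have "Q ** (transpose Q ** (A - C)) = ?P ** A - C"
    by (simp add: matrix_diff_ldistrib matrix_mul_assoc C)
  ultimately have "orthogonal (?P ** A - C) (A - ?P ** A)"
    by (simp add: orthogonal_def)
  then have "(norm ((?P ** A - C) + (A - ?P ** A)))\<^sup>2 = (norm (?P ** A - C))\<^sup>2 + (norm (A - ?P ** A))\<^sup>2"
    by (rule norm_add_Pythagorean)
  then have "(norm (A - ?P ** A))\<^sup>2 \<le> (norm (A - C))\<^sup>2"
    by simp
  then show ?thesis
    by (rule power2_le_imp_le) simp
qed

text \<open>
  The set of matrices of rank at most \<open>k\<close> is not compact, but by projecting onto ranges it suffices
  to minimise over the compact set of matrices with orthonormal columns.
\<close>

lemma is_best_rank_approx_best_rank_approx: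
  fixes A :: "real^'n^'m"
  assumes le: "CARD('k::finite) \<le> CARD('m)"
  shows "is_best_rank_approx CARD('k) A (best_rank_approx CARD('k) A)"
proof -
  let ?S = "{Q :: real^'k^'m. transpose Q ** Q = mat 1}"
  \<comment> \<open>The factorisation of the zero matrix, whose rank meets every bound, shows that
    the feasible set is nonempty.\<close>
  obtain Q0 :: "real^'k^'m" where "transpose Q0 ** Q0 = mat 1"
    using rank_le_orthonormal_factor[where C = "0 :: real^'n^'m" and 'k = 'k] le by auto
  then have "?S \<noteq> {}"
    by blast
  moreover have "continuous_on ?S (\<lambda>Q. norm (A - Q ** transpose Q ** A))"
    by (intro continuous_on_matrix_mult continuous_on_transpose continuous_intros)
  ultimately obtain Q where "Q \<in> ?S"
    and min: "\<And>Q'. Q' \<in> ?S \<Longrightarrow> norm (A - Q ** transpose Q ** A) \<le> norm (A - Q' ** transpose Q' ** A)"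
    using continuous_attains_inf[OF compact_orthonormal_columns] by blast
  have "rank (Q ** transpose Q ** A) \<le> rank Q"
    by (metis matrix_mul_assoc rank_mul_le_left)
  then have "rank (Q ** transpose Q ** A) \<le> CARD('k)"
    using rank_bound[of Q] by simp
  moreover have "norm (A - Q ** transpose Q ** A) \<le> norm (A - C)" if "rank C \<le> CARD('k)" for C
    using rank_le_orthonormal_factor[OF that le]
    by (metis (mono_tags, lifting) mem_Collect_eq min norm_diff_projection_le order_trans)
  ultimately have "is_best_rank_approx CARD('k) A (Q ** transpose Q ** A)"
    by (simp add: is_best_rank_approx_def)
  then show ?thesis
    unfolding best_rank_approx_def by (rule someI)
qed

text \<open>
  Since the rank constraint is invariant under scaling, optimality of \<open>M\<close> gives
  \<open>A \<bullet> M = (norm M)\<^sup>2\<close>, and comparing with the best multiple of \<open>B\<close> gives the bound.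
\<close>

lemma inner_le_best_rank_approx:
  fixes A B :: "real^'n^'m"
  assumes "CARD('k::finite) \<le> CARD('m)" and B: "rank B \<le> CARD('k)"
  shows "\<bar>A \<bullet> B\<bar> \<le> norm (best_rank_approx CARD('k) A) * norm B"
proof -
  define M where "M = best_rank_approx CARD('k) A"
  have rM: "rank M \<le> CARD('k)"
    and min: "\<And>C. rank C \<le> CARD('k) \<Longrightarrow> norm (A - M) \<le> norm (A - C)"
    using is_best_rank_approx_best_rank_approx[OF assms(1), of A]
    by (auto simp: is_best_rank_approx_def M_def)
  \<comment> \<open>Optimality of \<open>M\<close> against the competitor
    \<open>t *\<^sub>R C\<close>, with both squares expanded and the square of \<open>norm A\<close>
    cancelled.\<close>
  have ineq: "(norm M)\<^sup>2 - 2 * (A \<bullet> M) \<le> t\<^sup>2 * (norm C)\<^sup>2 - 2 * t * (A \<bullet> C)"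
    if "rank C \<le> CARD('k)" for C and t :: real
  proof -
    have "norm (A - M) \<le> norm (A - t *\<^sub>R C)"
      using rank_scaleR_le[of t C] that by (intro min) linarith
    then have "(norm (A - M))\<^sup>2 \<le> (norm (A - t *\<^sub>R C))\<^sup>2"
      by (rule power_mono) simp
    then show ?thesis
      unfolding power2_norm_eq_inner
      by (simp add: inner_diff_left inner_diff_right inner_commute power2_eq_square algebra_simps)
  qed
  have scaled: "(A \<bullet> C)\<^sup>2 \<le> (norm C)\<^sup>2 * (2 * (A \<bullet> M) - (norm M)\<^sup>2)"
    if "rank C \<le> CARD('k)" for C
  proof (cases "C = 0")
    case False
    then have pos: "0 < (norm C)\<^sup>2"
      by simp
    \<comment> \<open>Value of the quadratic in \<open>t\<close> at its minimiser
      \<open>a / n\<close>, with \<open>a = A \<bullet> C\<close> and \<open>n\<close> the square of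
      \<open>norm C\<close>.\<close>
    have "(a / n)\<^sup>2 * n - 2 * (a / n) * a = - (a\<^sup>2 / n)" if "0 < n" for a n :: real
      using that by (simp add: field_simps power2_eq_square)
    then have "(norm M)\<^sup>2 - 2 * (A \<bullet> M) \<le> - ((A \<bullet> C)\<^sup>2 / (norm C)\<^sup>2)"
      using ineq[OF that, of "(A \<bullet> C) / (norm C)\<^sup>2"] pos
      by metis
    then have "(A \<bullet> C)\<^sup>2 / (norm C)\<^sup>2 \<le> 2 * (A \<bullet> M) - (norm M)\<^sup>2"
      by simp
    then show ?thesis
      using pos by (simp add: pos_divide_le_eq mult.commute)
  qed simp
  \<comment> \<open>For \<open>C = M\<close> the bound rearranges to a perfect square that is at
    most 0.\<close>
  have "((A \<bullet> M) - (norm M)\<^sup>2)\<^sup>2 \<le> 0"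
    using scaled[OF rM] by (simp add: power2_eq_square algebra_simps)
  then have "A \<bullet> M = (norm M)\<^sup>2"
    by simp
  then have "\<bar>A \<bullet> B\<bar>\<^sup>2 \<le> (norm M * norm B)\<^sup>2"
    using scaled[OF B] by (simp add: power_mult_distrib mult.commute)
  then show ?thesis
    unfolding M_def by (rule power2_le_imp_le) simp
qed

section \<open>Gradient and Hessian under restricted convexity\<close>

text \<open>Riesz representation in coordinates gives existence of a gradient, and uniqueness of the
  derivative makes the definite description pick it.\<close>

lemma GDERIV_euclidean_grad:
  fixes f :: "'a::euclidean_space \<Rightarrow> real"
  assumes "f differentiable (at x)"
  shows "GDERIV f x :> euclidean_grad f x"
proof -
  obtain f' where f': "(f has_derivative f') (at x)"
    using assms by (auto simp: differentiable_def)
  then interpret bounded_linear f'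
    by (rule has_derivative_bounded_linear)
  define g where "g = (\<Sum>b\<in>Basis. f' b *\<^sub>R b)"
  have "f' h = h \<bullet> g" for h
  proof -
    have "f' h = f' (\<Sum>b\<in>Basis. (h \<bullet> b) *\<^sub>R b)"
      by (simp add: euclidean_representation)
    also have "\<dots> = h \<bullet> g"
      by (simp add: sum scaleR g_def inner_sum_right mult.commute)
    finally show ?thesis .
  qed
  then have "f' = (\<lambda>h. h \<bullet> g)"
    by auto
  then have g: "GDERIV f x :> g"
    using f' by (simp add: gderiv_def)
  show ?thesis
    unfolding euclidean_grad_def
  proof (rule theI[of _ g])
    fix g' assume "GDERIV f x :> g'"
    then have "(\<lambda>h. h \<bullet> g') = (\<lambda>h. h \<bullet> g)"
      using g has_derivative_unique unfolding gderiv_def by blast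
    then show "g' = g"
      by (metis vector_eq_ldot)
  qed (rule g)
qed

section \<open>Derivatives along lines and symmetry of the Hessian\<close>

lemma GDERIV_along_line:
  fixes f :: "'a::euclidean_space \<Rightarrow> real"
  assumes "\<And>x. f differentiable (at x)"
  shows "((\<lambda>t. f (a + t *\<^sub>R u)) has_real_derivative (euclidean_grad f (a + t *\<^sub>R u) \<bullet> u)) (at t)"
proof -
  have "((\<lambda>t. f (a + t *\<^sub>R u)) has_derivative (\<lambda>s. (s *\<^sub>R u) \<bullet> euclidean_grad f (a + t *\<^sub>R u))) (at t)"
    using GDERIV_euclidean_grad[OF assms, of "a + t *\<^sub>R u"] unfolding gderiv_def
    by (rule has_derivative_compose[rotated]) (auto intro!: derivative_eq_intros)
  then show ?thesis
    by (rule has_derivative_imp_has_field_derivative) (simp add: inner_commute)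
qed

lemma hess_along_line:
  fixes f :: "'a::euclidean_space \<Rightarrow> real"
  assumes "\<And>x. euclidean_grad f differentiable (at x)"
  shows "((\<lambda>t. euclidean_grad f (a + t *\<^sub>R u) \<bullet> v) has_real_derivative hess f (a + t *\<^sub>R u) u v) (at t)"
proof -
  let ?D = "frechet_derivative (euclidean_grad f) (at (a + t *\<^sub>R u))"
  have D: "(euclidean_grad f has_derivative ?D) (at (a + t *\<^sub>R u))"
    using assms by (simp flip: frechet_derivative_works)
  then have "((\<lambda>t. euclidean_grad f (a + t *\<^sub>R u)) has_derivative (\<lambda>s. ?D (s *\<^sub>R u))) (at t)"
    by (rule has_derivative_compose[rotated]) (auto intro!: derivative_eq_intros)
  then have "((\<lambda>t. euclidean_grad f (a + t *\<^sub>R u) \<bullet> v) has_derivative (\<lambda>s. ?D (s *\<^sub>R u) \<bullet> v)) (at t)"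
    by (rule has_derivative_inner_left)
  moreover have "?D (s *\<^sub>R u) = s *\<^sub>R ?D u" for s
    using has_derivative_linear[OF D] by (rule linear_scale)
  ultimately show ?thesis
    by (intro has_derivative_imp_has_field_derivative) (auto simp: hess_def)
qed

text \<open>The mean value theorem used twice, first along \<open>u\<close> and then along
  \<open>v\<close>. The gradient is thus differentiated along \<open>v\<close> and paired with
  \<open>u\<close>; exchanging \<open>u\<close> and \<open>v\<close> gives the other order with the
  same second difference.\<close>

lemma second_difference_hess:
  fixes f :: "'a::euclidean_space \<Rightarrow> real"
  assumes f: "\<And>x. f differentiable (at x)" and g: "\<And>x. euclidean_grad f differentiable (at x)"
    and "0 < t"
  obtains \<xi> \<eta> where "0 < \<xi>" "\<xi> < t" "0 < \<eta>" "\<eta> < t"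
    "f (x + t *\<^sub>R u + t *\<^sub>R v) - f (x + t *\<^sub>R u) - (f (x + t *\<^sub>R v) - f x)
      = t\<^sup>2 * hess f (x + \<xi> *\<^sub>R u + \<eta> *\<^sub>R v) v u"
proof -
  let ?g = "euclidean_grad f"
  define \<phi> where "\<phi> \<tau> = f ((x + t *\<^sub>R v) + \<tau> *\<^sub>R u) - f (x + \<tau> *\<^sub>R u)" for \<tau>
  have "(\<phi> has_real_derivative
      ?g ((x + t *\<^sub>R v) + \<tau> *\<^sub>R u) \<bullet> u - ?g (x + \<tau> *\<^sub>R u) \<bullet> u) (at \<tau>)" for \<tau>
    unfolding \<phi>_def by (intro DERIV_diff GDERIV_along_line f)
  then obtain \<xi> where \<xi>: "0 < \<xi>" "\<xi> < t"
    and 1: "\<phi> t - \<phi> 0 = (t - 0) * (?g ((x + t *\<^sub>R v) + \<xi> *\<^sub>R u) \<bullet> u - ?g (x + \<xi> *\<^sub>R u) \<bullet> u)"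
    using MVT2[OF \<open>0 < t\<close>, of \<phi> "\<lambda>\<tau>. ?g ((x + t *\<^sub>R v) + \<tau> *\<^sub>R u) \<bullet> u - ?g (x + \<tau> *\<^sub>R u) \<bullet> u"]
    by auto
  obtain \<eta> where \<eta>: "0 < \<eta>" "\<eta> < t"
    and 2: "?g ((x + \<xi> *\<^sub>R u) + t *\<^sub>R v) \<bullet> u - ?g ((x + \<xi> *\<^sub>R u) + 0 *\<^sub>R v) \<bullet> u
      = (t - 0) * hess f ((x + \<xi> *\<^sub>R u) + \<eta> *\<^sub>R v) v u"
    using MVT2[OF \<open>0 < t\<close>, of "\<lambda>s. ?g ((x + \<xi> *\<^sub>R u) + s *\<^sub>R v) \<bullet> u"
        "\<lambda>s. hess f ((x + \<xi> *\<^sub>R u) + s *\<^sub>R v) v u"] hess_along_line[OF g] by auto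
  have "\<phi> t - \<phi> 0 = t * (t * hess f (x + \<xi> *\<^sub>R u + \<eta> *\<^sub>R v) v u)"
    using 1 2 by (simp add: add.assoc add.commute[of "t *\<^sub>R v"])
  then have "f (x + t *\<^sub>R u + t *\<^sub>R v) - f (x + t *\<^sub>R u) - (f (x + t *\<^sub>R v) - f x)
      = t\<^sup>2 * hess f (x + \<xi> *\<^sub>R u + \<eta> *\<^sub>R v) v u"
    by (simp add: \<phi>_def power2_eq_square ac_simps)
  with \<xi> \<eta> show thesis
    by (rule that)
qed

text \<open>The symmetric second difference equates the two mixed values at two points near
  \<open>x\<close>. Continuity moves each of them by less than half of a supposed gap, a
  contradiction.\<close>

lemma hess_symmetric:
  fixes f :: "'a::euclidean_space \<Rightarrow> real"
  assumes "twice_cont_differentiable f"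
  shows "hess f x u v = hess f x v u"
proof (rule ccontr)
  assume neq: "hess f x u v \<noteq> hess f x v u"
  have f: "\<And>x. f differentiable (at x)" and g: "\<And>x. euclidean_grad f differentiable (at x)"
    and cont: "\<And>u v. continuous_on UNIV (\<lambda>x. hess f x u v)"
    using assms by (auto simp: twice_cont_differentiable_def)
  define e where "e = \<bar>hess f x u v - hess f x v u\<bar> / 2"
  have "0 < e"
    using neq by (simp add: e_def)
  have "\<exists>d>0. \<forall>y. dist y x < d \<longrightarrow> \<bar>hess f y u v - hess f x u v\<bar> < e" for u v
    using cont[of u v] \<open>0 < e\<close> unfolding continuous_on_iff dist_real_def by auto
  then obtain d1 d2 where d: "0 < d1" "0 < d2"
    and near1: "\<And>y. dist y x < d1 \<Longrightarrow> \<bar>hess f y u v - hess f x u v\<bar> < e"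
    and near2: "\<And>y. dist y x < d2 \<Longrightarrow> \<bar>hess f y v u - hess f x v u\<bar> < e"
    by metis
  \<comment> \<open>Small enough that both intermediate points stay within \<open>min d1 d2\<close>
    of \<open>x\<close>; the summand 1 keeps the denominator positive when \<open>u\<close> and
    \<open>v\<close> both vanish.\<close>
  define t where "t = min d1 d2 / (2 * (norm u + norm v + 1))"
  have "0 < t"
    using d by (simp add: t_def add_nonneg_pos)
  have pos: "0 < norm u + norm v + 1"
    by (smt (verit) norm_ge_zero)
  have small: "dist (x + a *\<^sub>R u' + b *\<^sub>R v') x < min d1 d2"
    if "0 < a" "a < t" "0 < b" "b < t" "norm u' + norm v' = norm u + norm v" for a b u' v'
  proof -
    have "dist (x + a *\<^sub>R u' + b *\<^sub>R v') x = norm (a *\<^sub>R u' + b *\<^sub>R v')"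
      by (simp add: dist_norm)
    also have "\<dots> \<le> a * norm u' + b * norm v'"
      using norm_triangle_ineq[of "a *\<^sub>R u'" "b *\<^sub>R v'"] that by simp
    also have "\<dots> \<le> t * norm u' + t * norm v'"
      using that by (intro add_mono mult_right_mono) auto
    also have "\<dots> < t * (2 * (norm u + norm v + 1))"
    proof -
      have "t * norm u' + t * norm v' = t * (norm u + norm v)"
        using that(5) by (simp flip: distrib_left)
      also have "\<dots> < t * (2 * (norm u + norm v + 1))"
        using \<open>0 < t\<close> pos by (intro mult_strict_left_mono) (auto simp: add_nonneg_pos)
      finally show ?thesis .
    qed
    also have "\<dots> = min d1 d2"
      using pos by (simp add: t_def)
    finally show ?thesis .
  qed
  obtain a b where ab: "0 < a" "a < t" "0 < b" "b < t"
    "f (x + t *\<^sub>R u + t *\<^sub>R v) - f (x + t *\<^sub>R u) - (f (x + t *\<^sub>R v) - f x)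
      = t\<^sup>2 * hess f (x + a *\<^sub>R u + b *\<^sub>R v) v u"
    by (rule second_difference_hess[OF f g \<open>0 < t\<close>])
  obtain a' b' where ab': "0 < a'" "a' < t" "0 < b'" "b' < t"
    "f (x + t *\<^sub>R v + t *\<^sub>R u) - f (x + t *\<^sub>R v) - (f (x + t *\<^sub>R u) - f x)
      = t\<^sup>2 * hess f (x + a' *\<^sub>R v + b' *\<^sub>R u) u v"
    by (rule second_difference_hess[OF f g \<open>0 < t\<close>])
  have swap: "x + t *\<^sub>R v + t *\<^sub>R u = x + t *\<^sub>R u + t *\<^sub>R v"
    by simp
  have "t\<^sup>2 * hess f (x + a *\<^sub>R u + b *\<^sub>R v) v u = t\<^sup>2 * hess f (x + a' *\<^sub>R v + b' *\<^sub>R u) u v"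
    using ab(5) ab'(5)[unfolded swap] by linarith
  then have "hess f (x + a *\<^sub>R u + b *\<^sub>R v) v u = hess f (x + a' *\<^sub>R v + b' *\<^sub>R u) u v"
    using \<open>0 < t\<close> by simp
  moreover have "\<bar>hess f (x + a *\<^sub>R u + b *\<^sub>R v) v u - hess f x v u\<bar> < e"
    using small[OF ab(1-4), of u v] by (intro near2) simp
  moreover have "\<bar>hess f (x + a' *\<^sub>R v + b' *\<^sub>R u) u v - hess f x u v\<bar> < e"
    using small[OF ab'(1-4), of v u] by (intro near1) simp
  moreover have "\<bar>hess f x u v - hess f x v u\<bar> \<le> \<bar>p - hess f x v u\<bar> + \<bar>p - hess f x u v\<bar>" for p
    by linarith
  ultimately show False
    unfolding e_def by (smt (verit) field_sum_of_halves)
qed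

text \<open>For unit vectors, polarisation and the parallelogram law give the bound \<delta>;
  normalising beforehand produces the product of the norms. The quadratic bound is assumed only on
  the span of \<open>D\<close> and \<open>G\<close>, because in the application only these
  combinations have controlled rank.\<close>

lemma polarization_bound:
  fixes b :: "'a::real_inner \<Rightarrow> 'a \<Rightarrow> real"
  assumes "bilinear b" and sym: "\<And>u v. b u v = b v u"
    and bound: "\<And>s t. \<bar>b (s *\<^sub>R D + t *\<^sub>R G) (s *\<^sub>R D + t *\<^sub>R G)\<bar> \<le> \<delta> * (norm (s *\<^sub>R D + t *\<^sub>R G))\<^sup>2"
  shows "\<bar>b D G\<bar> \<le> \<delta> * norm D * norm G"
proof (cases "D = 0 \<or> G = 0")
  case True
  then show ?thesis
    using assms(1) by (auto simp: bilinear_lzero bilinear_rzero)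
next
  case False
  define d g where "d = D /\<^sub>R norm D" and "g = G /\<^sub>R norm G"
  have n: "norm d = 1" "norm g = 1"
    using False by (auto simp: d_def g_def)
  have "b (d + g) (d + g) - b (d - g) (d - g) = 4 * b d g"
    using assms(1) sym[of g d]
    by (simp add: bilinear_ladd bilinear_radd bilinear_lsub bilinear_rsub)
  moreover have "\<bar>b (d + g) (d + g)\<bar> \<le> \<delta> * (norm (d + g))\<^sup>2"
    using bound[of "inverse (norm D)" "inverse (norm G)"] by (simp add: d_def g_def)
  moreover have "\<bar>b (d - g) (d - g)\<bar> \<le> \<delta> * (norm (d - g))\<^sup>2"
    using bound[of "inverse (norm D)" "- inverse (norm G)"] by (simp add: d_def g_def)
  moreover have "\<delta> * (norm (d + g))\<^sup>2 + \<delta> * (norm (d - g))\<^sup>2 = \<delta> * 4"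
  proof -
    have "(norm (d + g))\<^sup>2 + (norm (d - g))\<^sup>2 = 2 * (norm d)\<^sup>2 + 2 * (norm g)\<^sup>2"
      by (simp add: power2_norm_eq_inner inner_add inner_diff inner_commute)
    then show ?thesis
      using n by (simp flip: distrib_left)
  qed
  ultimately have "\<bar>b d g\<bar> \<le> \<delta>"
    by linarith
  moreover have "b D G = norm D * norm G * b d g"
    using False assms(1) by (simp add: d_def g_def bilinear_lmul bilinear_rmul field_simps)
  ultimately show ?thesis
    using mult_left_mono[of "\<bar>b d g\<bar>" \<delta> "norm D * norm G"]
    by (simp add: abs_mult mult.commute mult.left_commute)
qed

text \<open>Polarisation of the Hessian minus the inner product, whose quadratic form the restricted
  property bounds by \<delta> times the squared norm.\<close>

lemma restricted_hess_near_inner: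
  fixes f :: "real^'p^'p \<Rightarrow> real"
  assumes f: "twice_cont_differentiable f"
    and rscs: "restricted_strong_convex_smooth k l \<delta> f"
    and X: "rank X \<le> k" and DG: "rank D + rank G \<le> l"
  shows "\<bar>hess f X D G - D \<bullet> G\<bar> \<le> \<delta> * norm D * norm G"
proof (rule polarization_bound[where b = "\<lambda>u v. hess f X u v - u \<bullet> v"])
  have "linear (frechet_derivative (euclidean_grad f) (at X))"
    using f by (simp add: twice_cont_differentiable_def linear_frechet_derivative)
  then show "bilinear (\<lambda>u v. hess f X u v - u \<bullet> v)"
    unfolding bilinear_def hess_def
    by (auto intro!: linearI simp: linear_add linear_scale algebra_simps)
  show "hess f X u v - u \<bullet> v = hess f X v u - v \<bullet> u" for u v
    using hess_symmetric[OF f] by (simp add: inner_commute)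
  fix s t
  let ?W = "s *\<^sub>R D + t *\<^sub>R G"
  have "rank ?W \<le> l"
    using rank_add_le[of "s *\<^sub>R D" "t *\<^sub>R G"] rank_scaleR_le[of s D] rank_scaleR_le[of t G] DG
    by linarith
  then have "(1 - \<delta>) * (norm ?W)\<^sup>2 \<le> hess f X ?W ?W" "hess f X ?W ?W \<le> (1 + \<delta>) * (norm ?W)\<^sup>2"
    using rscs X unfolding restricted_strong_convex_smooth_def by blast+
  then show "\<bar>hess f X ?W ?W - ?W \<bullet> ?W\<bar> \<le> \<delta> * (norm ?W)\<^sup>2"
    by (simp add: power2_norm_eq_inner[symmetric] algebra_simps abs_le_iff)
qed

text \<open>Points on the line through \<open>Z\<close> and \<open>X\<close> have rank at most
  \<open>2 * k\<close>, and combinations of \<open>X - Z\<close> and \<open>G\<close> have rank at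
  most \<open>3 * k\<close>, so the Hessian estimate holds at the mean value point.\<close>

lemma restricted_grad_diff_near_inner:
  fixes f :: "real^'p^'p \<Rightarrow> real"
  assumes f: "twice_cont_differentiable f"
    and rscs: "restricted_strong_convex_smooth (2 * k) (4 * k) \<delta> f"
    and X: "rank X \<le> k" and Z: "rank Z \<le> k" and G: "rank G \<le> k"
  shows "\<bar>(euclidean_grad f X - euclidean_grad f Z - (X - Z)) \<bullet> G\<bar> \<le> \<delta> * norm (X - Z) * norm G"
proof -
  let ?g = "euclidean_grad f"
  define D where "D = X - Z"
  \<comment> \<open>The linear term is subtracted so that the increment of \<open>\<psi>\<close>
    from 0 to 1 is exactly the quantity to be bounded.\<close>
  define \<psi> where "\<psi> t = ?g (Z + t *\<^sub>R D) \<bullet> G - t * (D \<bullet> G)" for t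
  have "(\<psi> has_real_derivative hess f (Z + t *\<^sub>R D) D G - D \<bullet> G) (at t)" for t
  proof -
    have "((\<lambda>t. ?g (Z + t *\<^sub>R D) \<bullet> G) has_real_derivative hess f (Z + t *\<^sub>R D) D G) (at t)"
      using f by (intro hess_along_line) (simp add: twice_cont_differentiable_def)
    then show ?thesis
      unfolding \<psi>_def by (auto intro!: derivative_eq_intros)
  qed
  then obtain z where "\<psi> 1 - \<psi> 0 = (1 - 0) * (hess f (Z + z *\<^sub>R D) D G - D \<bullet> G)"
    using MVT2[of 0 1 \<psi> "\<lambda>t. hess f (Z + t *\<^sub>R D) D G - D \<bullet> G"] by auto
  moreover have "\<psi> 1 - \<psi> 0 = (?g X - ?g Z - (X - Z)) \<bullet> G"
    by (simp add: \<psi>_def D_def inner_diff_left)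
  moreover have "\<bar>hess f (Z + z *\<^sub>R D) D G - D \<bullet> G\<bar> \<le> \<delta> * norm D * norm G"
  proof (rule restricted_hess_near_inner[OF f rscs])
    have "Z + z *\<^sub>R D = (1 - z) *\<^sub>R Z + z *\<^sub>R X"
      by (simp add: D_def algebra_simps)
    then have "rank (Z + z *\<^sub>R D) = rank ((1 - z) *\<^sub>R Z + z *\<^sub>R X)"
      by simp
    then have "rank (Z + z *\<^sub>R D) \<le> rank Z + rank X"
      using rank_add_le[of "(1 - z) *\<^sub>R Z" "z *\<^sub>R X"] rank_scaleR_le[of "1 - z" Z] rank_scaleR_le[of z X]
      by linarith
    then show "rank (Z + z *\<^sub>R D) \<le> 2 * k"
      using X Z by linarith
    show "rank D + rank G \<le> 4 * k"
      using rank_diff_le[of X Z] X Z G unfolding D_def by linarith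
  qed
  ultimately show ?thesis
    by (simp add: D_def)
qed

section \<open>Gradients on the quotient\<close>

text \<open>An orthogonal factor cancels in the product with the transpose, so the image of an orbit
  is a singleton and \<open>the_elem\<close> returns its element.\<close>

lemma quotient_fun_orbit:
  fixes Y :: "real^'r^'p"
  shows "quotient_fun \<phi> (orbit Y) = \<phi> (Y ** transpose Y)"
proof -
  have "(Y ** Q) ** transpose (Y ** Q) = Y ** transpose Y" if "orthogonal_matrix Q" for Q
  proof -
    have "(Y ** Q) ** transpose (Y ** Q) = Y ** (Q ** transpose Q) ** transpose Y"
      by (simp add: matrix_transpose_mul matrix_mul_assoc)
    then show ?thesis
      using that by (simp add: orthogonal_matrix_def)
  qed
  moreover have "Y \<in> orbit Y"
    unfolding orbit_def using orthogonal_matrix_id matrix_mul_rid[of Y] by force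
  ultimately have "(\<lambda>Z. \<phi> (Z ** transpose Z)) ` orbit Y = {\<phi> (Y ** transpose Y)}"
    unfolding orbit_def by force
  then show ?thesis
    by (simp add: quotient_fun_def)
qed

text \<open>Symmetry of \<open>G\<close> merges the two terms of the product rule into
  \<open>(2 *\<^sub>R (G ** Y)) \<bullet> \<theta>\<close>, and it also makes this vector
  horizontal. Uniqueness follows by testing the difference of two candidates, itself horizontal,
  against itself.\<close>

lemma lifted_grad_quotient_fun:
  fixes Y :: "real^'r^'p"
  assumes \<phi>: "GDERIV \<phi> (Y ** transpose Y) :> G" and G: "transpose G = G"
  shows "lifted_grad (quotient_fun \<phi>) Y = 2 *\<^sub>R (G ** Y)"
proof -
  have "((\<lambda>Z :: real^'r^'p. Z ** transpose Z) has_derivative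
      (\<lambda>\<theta>. Y ** transpose \<theta> + \<theta> ** transpose Y)) (at Y)"
    by (intro bounded_bilinear.FDERIV[OF bounded_bilinear_matrix_mult]
        bounded_linear.has_derivative[OF bounded_linear_transpose] has_derivative_ident)
  then have "((\<lambda>Z. \<phi> (Z ** transpose Z)) has_derivative
      (\<lambda>\<theta>. (Y ** transpose \<theta> + \<theta> ** transpose Y) \<bullet> G)) (at Y)"
    using \<phi> unfolding gderiv_def by (rule has_derivative_compose)
  moreover have "(Y ** transpose \<theta> + \<theta> ** transpose Y) \<bullet> G = (2 *\<^sub>R (G ** Y)) \<bullet> \<theta>" for \<theta>
  proof -
    have "(Y ** transpose \<theta>) \<bullet> G = G \<bullet> (\<theta> ** transpose Y)"
      using inner_transpose[of "Y ** transpose \<theta>" G]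
      by (simp add: matrix_transpose_mul G inner_commute)
    then show ?thesis
      by (simp add: inner_add_left inner_matrix_mult_left[of G] inner_commute[of "\<theta> ** transpose Y"])
  qed
  moreover have "quotient_fun \<phi> \<circ> orbit = (\<lambda>Z :: real^'r^'p. \<phi> (Z ** transpose Z))"
    by (simp add: fun_eq_iff quotient_fun_orbit)
  ultimately have deriv: "frechet_derivative (quotient_fun \<phi> \<circ> orbit) (at Y) = (\<lambda>\<theta>. (2 *\<^sub>R (G ** Y)) \<bullet> \<theta>)"
    using frechet_derivative_at by fastforce
  have horizontal: "2 *\<^sub>R (G ** Y) \<in> horizontal Y"
    unfolding horizontal_def
    by (simp add: matrix_scalar_ac transpose_scalar matrix_transpose_mul G matrix_mul_assoc flip: scalar_matrix_assoc)
  show ?thesis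
    unfolding lifted_grad_def deriv metric_eq_inner
  proof (rule the_equality)
    fix \<xi> assume \<xi>: "\<xi> \<in> horizontal Y \<and> (\<forall>\<theta>\<in>horizontal Y. \<xi> \<bullet> \<theta> = 2 *\<^sub>R (G ** Y) \<bullet> \<theta>)"
    then have "\<xi> - 2 *\<^sub>R (G ** Y) \<in> horizontal Y"
      using horizontal by (simp add: horizontal_def matrix_diff_ldistrib transpose_diff)
    with \<xi> have "(\<xi> - 2 *\<^sub>R (G ** Y)) \<bullet> (\<xi> - 2 *\<^sub>R (G ** Y)) = 0"
      by (simp only: inner_diff_left[of \<xi>] diff_self)
    then show "\<xi> = 2 *\<^sub>R (G ** Y)"
      by simp
  qed (use horizontal in simp)
qed

lemma GDERIV_half_dist_sq: "GDERIV (\<lambda>X. (norm (X - A))\<^sup>2 / 2) X :> X - A"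
proof -
  have "((\<lambda>X. (X - A) \<bullet> (X - A) / 2) has_derivative (\<lambda>h. h \<bullet> (X - A))) (at X)"
    by (auto intro!: derivative_eq_intros simp: inner_commute)
  then show ?thesis
    by (simp add: gderiv_def power2_norm_eq_inner)
qed

text \<open>At a symmetric point, differentiating \<open>f Z = f (transpose Z)\<close> gives two
  expressions for one derivative. The result supplies the symmetry premise of
  \<open>lifted_grad_quotient_fun\<close>.\<close>

lemma gradient_transpose_invariant:
  fixes f :: "real^'p^'p \<Rightarrow> real"
  assumes "GDERIV f X :> G" "\<And>Z. f Z = f (transpose Z)" "transpose X = X"
  shows "transpose G = G"
proof -
  have "(f has_derivative (\<lambda>h. h \<bullet> G)) (at (transpose X))"
    using assms by (simp add: gderiv_def)
  then have "((\<lambda>Z. f (transpose Z)) has_derivative (\<lambda>h. transpose h \<bullet> G)) (at X)"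
    by (rule has_derivative_compose[rotated])
      (intro bounded_linear.has_derivative[OF bounded_linear_transpose] has_derivative_ident)
  then have "(f has_derivative (\<lambda>h. transpose h \<bullet> G)) (at X)"
    using assms(2) by simp
  then have "(\<lambda>h. transpose h \<bullet> G) = (\<lambda>h. h \<bullet> G)"
    using assms(1) has_derivative_unique unfolding gderiv_def by blast
  then have "h \<bullet> transpose G = h \<bullet> G" for h
    by (metis inner_transpose transpose_transpose)
  then show ?thesis
    by (metis vector_eq_ldot)
qed

section \<open>Singular values of the target factor\<close>

lemma diag_mat_mult_vector: "diag_mat d *v x = (\<chi> i. d $ i * x $ i)"
  by (simp add: diag_mat_def matrix_vector_mult_def vec_eq_iff if_distribR if_distrib cong: if_cong)

lemma transpose_diag_mat: "transpose (diag_mat d) = diag_mat d"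
  by (auto simp: transpose_def diag_mat_def vec_eq_iff)

lemma diag_mat_mult: "diag_mat d ** diag_mat e = diag_mat (\<chi> i. d $ i * e $ i)"
  by (simp add: matrix_eq diag_mat_mult_vector mult.assoc flip: matrix_vector_mul_assoc)

text \<open>The property of \<open>Ys\<close> from which its singular values can be read off: they
  are the entries of \<open>t\<close>, with multiplicity.\<close>

locale diagonal_gram =
  fixes A :: "real^'r^'p" and t :: "real^'r"
  assumes gram: "transpose A ** A = diag_mat (\<chi> i. (t $ i)\<^sup>2)" and pos: "\<And>i. 0 < t $ i"
begin

text \<open>Nonnegativity of \<open>s\<close> and positivity of \<open>t\<close> allow squares to be
  cancelled. The right-hand side is a coordinate subspace, so its dimension is a
  cardinality.\<close>

lemma eigenspace_eq:
  assumes "0 \<le> s"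
  shows "{x. (transpose A ** A) *v x = s\<^sup>2 *\<^sub>R x} = {x. \<forall>i. i \<notin> {i. t $ i = s} \<longrightarrow> x $ i = 0}"
proof -
  have "(t $ i)\<^sup>2 = s\<^sup>2 \<longleftrightarrow> t $ i = s" for i
    using pos[of i] assms by (simp add: power2_eq_iff_nonneg)
  then show ?thesis
    by (auto simp: gram diag_mat_mult_vector vec_eq_iff)
qed

lemma singular_values_eq: "singular_values A = range (($) t)"
proof (intro equalityI subsetI)
  fix s assume "s \<in> singular_values A"
  then obtain x where "0 \<le> s" "x \<noteq> 0" "x \<in> {x. (transpose A ** A) *v x = s\<^sup>2 *\<^sub>R x}"
    by (auto simp: singular_values_def)
  then have "x \<noteq> 0" "x \<in> {x. \<forall>i. i \<notin> {i. t $ i = s} \<longrightarrow> x $ i = 0}"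
    using eigenspace_eq by auto
  then obtain i where "t $ i = s"
    by (auto simp: vec_eq_iff)
  then show "s \<in> range (($) t)"
    by blast
next
  fix s assume "s \<in> range (($) t)"
  then obtain i where i: "s = t $ i"
    by blast
  have "axis i 1 \<in> {x. (transpose A ** A) *v x = s\<^sup>2 *\<^sub>R x}"
    using pos[of i] by (subst eigenspace_eq) (auto simp: i axis_def)
  moreover have "axis i (1 :: real) \<noteq> 0"
    by (simp add: axis_eq_0_iff)
  ultimately show "s \<in> singular_values A"
    using pos[of i] unfolding singular_values_def i by fastforce
qed

lemma sv_mult_eq: "0 \<le> s \<Longrightarrow> sv_mult A s = card {i. t $ i = s}"
  unfolding sv_mult_def
  by (subst eigenspace_eq) (simp_all only: dim_vec_eq[symmetric] dim_substandard_cart)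

text \<open>The multiplicities are the sizes of the fibres of \<open>($) t\<close>, so summing them
  counts indices.\<close>

lemma sum_sv_mult_ge: "(\<Sum>u\<in>{u \<in> singular_values A. s \<le> u}. sv_mult A u) = card {i. s \<le> t $ i}"
proof -
  have "(\<Sum>u\<in>{u \<in> singular_values A. s \<le> u}. sv_mult A u)
      = (\<Sum>u\<in>($) t ` {i. s \<le> t $ i}. sum (\<lambda>_. 1) {i \<in> {i. s \<le> t $ i}. t $ i = u})"
  proof (rule sum.cong)
    show "{u \<in> singular_values A. s \<le> u} = ($) t ` {i. s \<le> t $ i}"
      by (auto simp: singular_values_eq)
    fix u assume "u \<in> ($) t ` {i. s \<le> t $ i}"
    then obtain j where "u = t $ j" "s \<le> t $ j"
      by blast
    then show "sv_mult A u = sum (\<lambda>_. 1) {i \<in> {i. s \<le> t $ i}. t $ i = u}"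
      using pos[of j] by (simp add: sv_mult_eq) (metis (mono_tags, lifting))
  qed
  also have "\<dots> = card {i. s \<le> t $ i}"
    by (subst sum.image_gen[symmetric]) simp_all
  finally show ?thesis .
qed

lemma sing_val_eq: "sing_val k A = Max {s \<in> range (($) t). k \<le> card {i. s \<le> t $ i}}"
  unfolding sing_val_def sum_sv_mult_ge by (simp add: singular_values_eq)

text \<open>\<open>Max\<close> needs a nonempty set: the least entry of \<open>t\<close> qualifies
  because all indices count for it. The maximum is then an entry of \<open>t\<close>.\<close>

lemma sing_val_last_pos: "0 < sing_val CARD('r) A"
proof -
  let ?S = "{s \<in> range (($) t). CARD('r) \<le> card {i. s \<le> t $ i}}"
  have "{i. Min (range (($) t)) \<le> t $ i} = UNIV"
    by auto
  moreover have "Min (range (($) t)) \<in> range (($) t)"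
    by (rule Min_in) auto
  ultimately have "Min (range (($) t)) \<in> ?S"
    by simp
  then have "?S \<noteq> {}"
    by blast
  then have "Max ?S \<in> ?S"
    by (intro Max_in) auto
  then show ?thesis
    using pos by (auto simp: sing_val_eq)
qed

lemma spectral_norm_le_sing_val_1: "spectral_norm A \<le> sing_val 1 A"
proof (rule spectral_norm_le)
  fix x
  let ?m = "sing_val 1 A"
  \<comment> \<open>The index \<open>i\<close> itself makes the count at least 1, so every entry
    competes for the maximum.\<close>
  have le: "t $ i \<le> ?m" for i
    unfolding sing_val_eq
  proof (rule Max_ge)
    have "0 < card {j. t $ i \<le> t $ j}"
      by (auto simp: card_gt_0_iff)
    then show "t $ i \<in> {s \<in> range (($) t). 1 \<le> card {i. s \<le> t $ i}}"
      by auto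
  qed simp
  have m: "0 \<le> ?m"
    using le pos by (meson less_le_trans less_imp_le)
  have "(norm (A *v x))\<^sup>2 = (\<Sum>i\<in>UNIV. (t $ i)\<^sup>2 * (x $ i)\<^sup>2)"
    unfolding norm_matrix_vector_sq gram diag_mat_mult_vector
    by (simp add: inner_vec_def power2_eq_square ac_simps)
  also have "\<dots> \<le> (\<Sum>i\<in>UNIV. ?m\<^sup>2 * (x $ i)\<^sup>2)"
    using pos le by (intro sum_mono mult_right_mono power_mono) (auto simp: less_imp_le)
  also have "\<dots> = (?m * norm x)\<^sup>2"
    unfolding power_mult_distrib power2_norm_eq_inner
    by (simp add: inner_vec_def power2_eq_square sum_distrib_left)
  finally show "norm (A *v x) \<le> ?m * norm x"
    by (rule power2_le_imp_le) (intro mult_nonneg_nonneg m norm_ge_zero)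
qed

end

text \<open>Each \<open>s $ i\<close> is the quadratic form of \<open>X\<close> at a column of
  \<open>U\<close>, hence nonnegative, and it is nonzero by the reduced form. The square roots
  therefore multiply back to \<open>diag_mat s\<close>.\<close>

lemma diagonal_gram_eigendecomp:
  assumes "psd X" "reduced_eigendecomp X U s"
  defines "Y \<equiv> U ** diag_mat (\<chi> i. sqrt (s $ i))"
  shows "diagonal_gram Y (\<chi> i. sqrt (s $ i))" and "Y ** transpose Y = X"
proof -
  have UU: "transpose U ** U = mat 1" and nz: "\<And>i. s $ i \<noteq> 0"
    and X: "X = U ** diag_mat s ** transpose U"
    using assms(2) by (auto simp: reduced_eigendecomp_def)
  have s: "0 < s $ i" for i
  proof -
    have "transpose U ** (U ** diag_mat s ** transpose U) ** U = diag_mat s"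
      by (metis UU matrix_mul_assoc matrix_mul_lid matrix_mul_rid)
    then have "s $ i = axis i 1 \<bullet> ((transpose U ** X ** U) *v axis i 1)"
      by (simp add: X diag_mat_mult_vector inner_axis' )
    also have "\<dots> = axis i 1 \<bullet> (transpose U *v (X *v (U *v axis i 1)))"
      by (simp only: matrix_vector_mul_assoc matrix_mul_assoc)
    also have "\<dots> = (U *v axis i 1) \<bullet> (X *v (U *v axis i 1))"
      using dot_lmul_matrix[of "axis i 1" "transpose U" "X *v (U *v axis i 1)"] by simp
    also have "\<dots> \<ge> 0"
      using assms(1) by (simp add: psd_def)
    finally show ?thesis
      using nz[of i] by simp
  qed
  have D: "diag_mat (\<chi> i. sqrt (s $ i)) ** diag_mat (\<chi> i. sqrt (s $ i)) = diag_mat s"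
    using s by (simp add: diag_mat_mult less_imp_le)
  have "transpose Y ** Y = diag_mat (\<chi> i. sqrt (s $ i)) ** (transpose U ** U) ** diag_mat (\<chi> i. sqrt (s $ i))"
    by (simp add: Y_def matrix_transpose_mul transpose_diag_mat matrix_mul_assoc)
  then show "diagonal_gram Y (\<chi> i. sqrt (s $ i))"
    using s by unfold_locales (simp_all add: UU D less_imp_le)
  have "Y ** transpose Y = U ** (diag_mat (\<chi> i. sqrt (s $ i)) ** diag_mat (\<chi> i. sqrt (s $ i))) ** transpose U"
    by (simp add: Y_def matrix_transpose_mul transpose_diag_mat matrix_mul_assoc)
  then show "Y ** transpose Y = X"
    by (simp add: D X)
qed

section \<open>Lower bounds for the gradient\<close>

locale restricted_objective =
  fixes f :: "real^'p^'p \<Rightarrow> real" and Ys :: "real^'r^'p" and \<delta> :: real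
  assumes card_le: "CARD('r) \<le> CARD('p)"
    and f_C2: "twice_cont_differentiable f"
    and f_sym: "\<And>X. f X = f (transpose X)"
    and \<delta>_nonneg: "0 \<le> \<delta>"
    and rscs: "restricted_strong_convex_smooth (2 * CARD('r)) (4 * CARD('r)) \<delta> f"
begin

abbreviation Xs :: "real^'p^'p" where "Xs \<equiv> Ys ** transpose Ys"
abbreviation N :: real where "N \<equiv> norm (best_rank_approx CARD('r) (euclidean_grad f Xs))"
abbreviation grad_h :: "real^'r^'p \<Rightarrow> real^'r^'p" where "grad_h \<equiv> lifted_grad (obj_h f)"
abbreviation grad_H :: "real^'r^'p \<Rightarrow> real^'r^'p" where "grad_H \<equiv> lifted_grad (obj_H Xs)"

lemma grad_h_eq: "grad_h Y = 2 *\<^sub>R (euclidean_grad f (Y ** transpose Y) ** Y)"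
proof -
  have G: "GDERIV f (Y ** transpose Y) :> euclidean_grad f (Y ** transpose Y)"
    using f_C2 by (intro GDERIV_euclidean_grad) (simp add: twice_cont_differentiable_def)
  show ?thesis
    unfolding obj_h_def
    by (rule lifted_grad_quotient_fun[OF G gradient_transpose_invariant[OF G f_sym]])
      (simp add: matrix_transpose_mul)
qed

lemma grad_H_eq: "grad_H Y = 2 *\<^sub>R ((Y ** transpose Y - Xs) ** Y)"
  unfolding obj_H_def
  by (rule lifted_grad_quotient_fun[OF GDERIV_half_dist_sq])
    (simp add: transpose_diff matrix_transpose_mul)

text \<open>\<open>Z ** transpose Y\<close> has rank at most \<open>CARD('r)\<close>, so it is
  admissible both for the gradient difference estimate and for the bound by the best approximation.
  The later estimates choose \<open>Z\<close>.\<close>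

lemma grad_near_residual:
  fixes Y Z :: "real^'r^'p"
  defines "X \<equiv> Y ** transpose Y"
  shows "\<bar>(euclidean_grad f X - (X - Xs)) \<bullet> (Z ** transpose Y)\<bar>
    \<le> (\<delta> * (norm X + norm Xs) + N) * norm (Z ** transpose Y)"
proof -
  have rank: "rank (A ** transpose B) \<le> CARD('r)" for A B :: "real^'r^'p"
    using rank_mul_le_left[of A "transpose B"] rank_bound[of A] by simp
  let ?G = "Z ** transpose Y"
  have "\<bar>(euclidean_grad f X - euclidean_grad f Xs - (X - Xs)) \<bullet> ?G\<bar> \<le> \<delta> * norm (X - Xs) * norm ?G"
    unfolding X_def by (intro restricted_grad_diff_near_inner[OF f_C2 rscs] rank)
  also have "\<dots> \<le> \<delta> * (norm X + norm Xs) * norm ?G"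
    by (intro mult_right_mono mult_left_mono norm_triangle_ineq4 \<delta>_nonneg norm_ge_zero)
  finally have "\<bar>(euclidean_grad f X - euclidean_grad f Xs - (X - Xs)) \<bullet> ?G\<bar>
    \<le> \<delta> * (norm X + norm Xs) * norm ?G" .
  moreover have "\<bar>euclidean_grad f Xs \<bullet> ?G\<bar> \<le> N * norm ?G"
    by (intro inner_le_best_rank_approx card_le rank)
  moreover have "(euclidean_grad f X - (X - Xs)) \<bullet> ?G
      = (euclidean_grad f X - euclidean_grad f Xs - (X - Xs)) \<bullet> ?G + euclidean_grad f Xs \<bullet> ?G"
    by (simp add: inner_diff_left)
  ultimately show ?thesis
    unfolding distrib_right by linarith
qed

text \<open>With \<open>Z = W\<close> the tested quantity is the square of \<open>norm W\<close>,
  while its bound is linear in \<open>norm W\<close>; one factor cancels.\<close>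

lemma norm_grad_h_ge_grad_H:
  "norm (grad_h Y) \<ge> norm (grad_H Y)
    - 2 * (\<delta> * (norm (Y ** transpose Y) + norm Xs) + N) * spectral_norm Y"
proof -
  let ?X = "Y ** transpose Y"
  define c where "c = \<delta> * (norm ?X + norm Xs) + N"
  define W where "W = (euclidean_grad f ?X - (?X - Xs)) ** Y"
  have c: "0 \<le> c"
    using \<delta>_nonneg by (simp add: c_def)
  have "(norm W)\<^sup>2 = (euclidean_grad f ?X - (?X - Xs)) \<bullet> (W ** transpose Y)"
    unfolding power2_norm_eq_inner
    by (subst (1) W_def) (rule inner_matrix_mult_left)
  also have "\<dots> \<le> c * norm (W ** transpose Y)"
    using grad_near_residual[of Y W] unfolding c_def by linarith
  also have "\<dots> \<le> c * (spectral_norm Y * norm W)"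
    by (intro mult_left_mono norm_matrix_mult_transpose_le c)
  finally have "norm W * norm W \<le> c * spectral_norm Y * norm W"
    by (simp add: power2_eq_square mult.assoc)
  then have W: "norm W \<le> c * spectral_norm Y"
    using c spectral_norm_nonneg[of Y] by (cases "norm W = 0") auto
  have "grad_H Y = grad_h Y - 2 *\<^sub>R W"
    by (simp add: grad_h_eq grad_H_eq W_def matrix_diff_rdistrib flip: scaleR_diff_right)
  then have "norm (grad_H Y) \<le> norm (grad_h Y) + 2 * norm W"
    using norm_triangle_ineq4[of "grad_h Y" "2 *\<^sub>R W"] by simp
  with W show ?thesis
    by (simp add: c_def algebra_simps)
qed

text \<open>\<open>Y ** transpose Y ** Y\<close> splits into half the gradient and
  \<open>Xs ** Y\<close>; its spectral norm is at least the cube of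
  \<open>spectral_norm Y\<close>.\<close>

lemma norm_grad_H_ge:
  "norm (grad_H Y) \<ge> 2 * spectral_norm Y * ((spectral_norm Y)\<^sup>2 - (spectral_norm Ys)\<^sup>2)"
proof -
  let ?W = "(Y ** transpose Y - Xs) ** Y"
  have "(spectral_norm Y)^3 \<le> spectral_norm (?W + Xs ** Y)"
    using spectral_norm_cube_le[of Y] by (simp add: matrix_diff_rdistrib)
  also have "\<dots> \<le> spectral_norm ?W + spectral_norm (Xs ** Y)"
    by (rule spectral_norm_triangle)
  also have "\<dots> \<le> norm ?W + (spectral_norm Ys)\<^sup>2 * spectral_norm Y"
  proof (intro add_mono spectral_norm_le_norm)
    have "spectral_norm (Xs ** Y) \<le> spectral_norm Xs * spectral_norm Y"
      by (rule spectral_norm_mult_le)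
    then show "spectral_norm (Xs ** Y) \<le> (spectral_norm Ys)\<^sup>2 * spectral_norm Y"
      using spectral_norm_gram[of "transpose Ys"] by (simp add: spectral_norm_transpose)
  qed
  finally show ?thesis
    by (simp add: grad_H_eq power2_eq_square power3_eq_cube algebra_simps)
qed

lemma norm_grad_h_ge_spectral:
  "norm (grad_h Y) \<ge> 2 * spectral_norm Y * ((spectral_norm Y)\<^sup>2 - (spectral_norm Ys)\<^sup>2
    - (\<delta> * (norm (Y ** transpose Y) + norm Xs) + N))"
  using norm_grad_h_ge_grad_H[of Y] norm_grad_H_ge[of Y] by (simp add: algebra_simps)

text \<open>The choice \<open>Z = Y\<close>, followed by Cauchy-Schwarz for the gradient against
  \<open>Y\<close> and division by \<open>norm Y\<close>.\<close>

lemma norm_grad_h_ge_frobenius: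
  fixes Y :: "real^'r^'p"
  defines "x \<equiv> norm (Y ** transpose Y)"
  assumes "Y \<noteq> 0"
  shows "norm (grad_h Y) \<ge> 2 * (x / norm Y) * ((1 - \<delta>) * x - (1 + \<delta>) * norm Xs - N)"
proof -
  let ?X = "Y ** transpose Y" and ?g = "euclidean_grad f (Y ** transpose Y)"
  have "(?X - Xs) \<bullet> ?X - (\<delta> * (x + norm Xs) + N) * x \<le> ?g \<bullet> ?X"
    using grad_near_residual[of Y Y] unfolding x_def inner_diff_left by linarith
  moreover have "x * x - norm Xs * x \<le> (?X - Xs) \<bullet> ?X"
    using norm_cauchy_schwarz[of Xs ?X]
    by (simp add: x_def inner_diff_left flip: power2_eq_square power2_norm_eq_inner)
  moreover have "?g \<bullet> ?X \<le> norm (?g ** Y) * norm Y"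
    using norm_cauchy_schwarz[of "?g ** Y" Y] by (simp add: inner_matrix_mult_left)
  ultimately have "x * ((1 - \<delta>) * x - (1 + \<delta>) * norm Xs - N) \<le> norm (?g ** Y) * norm Y"
    by (simp add: algebra_simps)
  then show ?thesis
    using \<open>Y \<noteq> 0\<close> by (simp add: grad_h_eq field_simps)
qed

end

text \<open>Covers brackets \<open>b < B\<close> of either sign. For positive \<open>B\<close> the
  factors are compared after replacing \<open>b\<close> by \<open>max b 0\<close>; otherwise
  \<open>b\<close> is negative and nonnegativity of \<open>l\<close> suffices. The third region
  needs both cases, and \<open>c = 0\<close> when \<gamma> = 0.\<close>

lemma mult_less_threshold:
  fixes c p q b B l :: real
  assumes "0 \<le> c" "c \<le> p" "p \<le> q" "0 < p" "b < B" "2 * q * B \<le> l" "0 \<le> l"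
  shows "2 * c * b \<le> l" and "0 < c \<Longrightarrow> 2 * c * b < l"
proof -
  have strict: "2 * c * b < l" if "0 < B"
  proof -
    have "c * b \<le> c * max b 0"
      using assms by (intro mult_left_mono) auto
    also have "\<dots> \<le> p * max b 0"
      using assms by (intro mult_right_mono) auto
    also have "\<dots> < p * B"
      using assms that by (intro mult_strict_left_mono) auto
    also have "\<dots> \<le> q * B"
      using assms that by (intro mult_right_mono) auto
    finally show ?thesis
      using assms by simp
  qed
  show "2 * c * b \<le> l"
  proof (cases "0 < B")
    case False
    then have "c * b \<le> 0"
      using assms by (intro mult_nonneg_nonpos) auto
    with assms(7) show ?thesis
      by simp
  qed (use strict in simp)
  show "2 * c * b < l" if "0 < c"
  proof (cases "0 < B")
    case False
    then have "c * b < 0"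
      using assms that by (intro mult_pos_neg) auto
    with assms(7) show ?thesis
      by simp
  qed (use strict in simp)
qed

text \<open>Strictness carries conditions because of degenerate parameters: if \<open>f\<close> is
  half the squared distance to \<open>Xs\<close> and \<delta> = 0, then \<open>N = 0\<close> and the
  gradient vanishes at \<open>Ys\<close>, where the right-hand side is 0 for \<beta> = 0 in the
  second region (with \<gamma> at least 1) and for \<gamma> = 0 in the third.\<close>

theorem theorem5:
  fixes f :: "real^'p^'p \<Rightarrow> real"
    and Xs :: "real^'p^'p" and U Ys :: "real^'r^'p" and s :: "real^'r"
    and \<delta> \<mu> \<alpha> \<beta> \<gamma> N \<kappa> \<sigma> S \<delta>min \<Psi> :: real
  assumes r_le_p: "CARD('r) \<le> CARD('p)"
    and f_C2: "twice_cont_differentiable f"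
    and f_sym: "\<And>X. f X = f (transpose X)"
    and \<delta>: "0 \<le> \<delta>" "\<delta> < 1"
    and rscs: "restricted_strong_convex_smooth (2 * CARD('r)) (4 * CARD('r)) \<delta> f"
    and Xs: "psd Xs" "rank Xs = CARD('r)" "reduced_eigendecomp Xs U s"
    and Ys: "Ys = U ** diag_mat (\<chi> i. sqrt (s $ i))"
    and params: "0 \<le> \<mu>" "0 \<le> \<alpha>" "0 \<le> \<beta>" "0 \<le> \<gamma>"
    and \<kappa>: "\<kappa> = cond_num Ys"
    and \<sigma>: "\<sigma> = sing_val CARD('r) Ys"
    and S: "S = norm (Ys ** transpose Ys)"
    and N: "N = norm (best_rank_approx CARD('r) (euclidean_grad f Xs))"
    and \<delta>min: "\<delta>min = Min {\<alpha> * \<mu> / (32 * \<kappa>\<^sup>2 * \<beta> * (1 + \<gamma>)) * (\<sigma>\<^sup>2 / S),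
                          (\<beta>\<^sup>2 - 1) / (4 * (1 + \<gamma>)) * ((spectral_norm Ys)\<^sup>2 / S),
                          (\<gamma> - 1) / (4 * (\<gamma> + 1))}"
    and \<Psi>: "\<Psi> = Min {\<alpha> * \<mu> / (32 * \<kappa>\<^sup>2 * \<beta>) * \<sigma>\<^sup>2,
                    (\<beta>\<^sup>2 - 1) / 4 * (spectral_norm Ys)\<^sup>2,
                    (\<gamma> - 1) / 4 * S}"
  shows
    "(\<forall>Y \<in> region1 Xs Ys \<mu> \<alpha> \<beta> \<gamma>.
       norm (lifted_grad (obj_h f) Y) \<ge>
         \<alpha> * \<mu> * \<sigma>^3 / (4 * \<kappa>)
           - (2 * \<delta> * \<beta> * (1 + \<gamma>) * spectral_norm Ys * S + 2 * \<beta> * spectral_norm Ys * N)) \<and>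
     (\<forall>Y \<in> region2 Ys \<beta> \<gamma>.
       (let lhs = norm (lifted_grad (obj_h f) Y);
            rhs = 2 * (\<beta>^3 - \<beta>) * (spectral_norm Ys)^3
              - (2 * \<delta> * (1 + \<gamma>) * spectral_norm Y * S + 2 * spectral_norm Y * N)
        in lhs \<ge> rhs \<and> (0 < \<beta> \<or> 0 < \<delta> \<or> 0 < N \<longrightarrow> lhs > rhs))) \<and>
     (\<forall>Y \<in> region3 Ys \<gamma>.
       (let lhs = norm (lifted_grad (obj_h f) Y);
            rhs = (2 * (\<gamma> - 1) - 2 * \<delta> * (\<gamma> + 1)) * \<gamma> powr (1/2) * S powr (3/2) / sqrt (real CARD('r))
              - 2 * \<gamma> powr (1/2) * S powr (1/2) * N / sqrt (real CARD('r))
        in lhs \<ge> rhs \<and> (0 < \<gamma> \<longrightarrow> lhs > rhs))) \<and>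
     (\<beta> > 1 \<and> \<gamma> > 1 \<and> \<delta> \<le> \<delta>min \<and> N \<le> \<Psi> \<longrightarrow>
       (\<forall>Y \<in> region1 Xs Ys \<mu> \<alpha> \<beta> \<gamma>.
          norm (lifted_grad (obj_h f) Y) > \<alpha> * \<mu> * \<sigma>^3 / (8 * \<kappa>)) \<and>
       (\<forall>Y \<in> region2 Ys \<beta> \<gamma>.
          norm (lifted_grad (obj_h f) Y) > (\<beta>^3 - \<beta>) * (spectral_norm Ys)^3) \<and>
       (\<forall>Y \<in> region3 Ys \<gamma>.
          norm (lifted_grad (obj_h f) Y) >
            (\<gamma> - 1) * \<gamma> powr (1/2) * S powr (3/2) / sqrt (real CARD('r))) \<and>
       (0 < \<alpha> \<and> 0 < \<mu> \<longrightarrow> \<alpha> * \<mu> * \<sigma>^3 / (8 * \<kappa>) > 0) \<and>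
       (\<beta>^3 - \<beta>) * (spectral_norm Ys)^3 > 0 \<and>
       (\<gamma> - 1) * \<gamma> powr (1/2) * S powr (3/2) / sqrt (real CARD('r)) > 0)"
proof -
  interpret diagonal_gram Ys "\<chi> i. sqrt (s $ i)"
    unfolding Ys using Xs by (intro diagonal_gram_eigendecomp)
  have Xs_eq: "Ys ** transpose Ys = Xs"
    unfolding Ys using Xs by (intro diagonal_gram_eigendecomp)
  interpret restricted_objective f Ys \<delta>
    by unfold_locales (fact r_le_p f_C2 f_sym \<delta> rscs)+
  define T where "T = spectral_norm Ys"
  define lhs where "lhs Y = norm (lifted_grad (obj_h f) Y)" for Y :: "real^'r^'p"
  define x where "x Y = norm (Y ** transpose Y)" for Y :: "real^'r^'p"
  have S': "S = norm Xs"
    by (simp add: S Xs_eq)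
  have ge_H: "lhs Y \<ge> norm (lifted_grad (obj_H Xs) Y) - 2 * (\<delta> * (x Y + S) + N) * spectral_norm Y"
    and ge_sp: "lhs Y \<ge> 2 * spectral_norm Y * ((spectral_norm Y)\<^sup>2 - T\<^sup>2 - (\<delta> * (x Y + S) + N))" for Y
    using norm_grad_h_ge_grad_H[of Y] norm_grad_h_ge_spectral[of Y]
    unfolding lhs_def x_def T_def S' N Xs_eq by simp_all
  have ge_F: "lhs Y \<ge> 2 * (x Y / norm Y) * ((1 - \<delta>) * x Y - (1 + \<delta>) * S - N)" if "Y \<noteq> 0" for Y
    using norm_grad_h_ge_frobenius[OF that]
    unfolding lhs_def x_def S' N Xs_eq by simp
  have lhs0: "0 \<le> lhs Y" for Y
    by (simp add: lhs_def)
  have N0: "0 \<le> N" and x0: "0 \<le> x Y" for Y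
    by (simp_all add: N x_def)
  \<comment> \<open>The rank of \<open>Xs\<close> is \<open>CARD('r)\<close>, the size of a nonempty
    type, hence positive.\<close>
  have "Xs \<noteq> 0"
    using Xs(2) rank_eq_0[of Xs] by auto
  then have "0 < S" and "Ys \<noteq> 0"
    using Xs_eq by (auto simp: S')
  then have "0 < T"
    using spectral_norm_nonneg[of Ys] spectral_norm_eq_0_iff[of Ys] unfolding T_def by linarith
  have "0 < \<sigma>"
    using sing_val_last_pos \<sigma> by simp
  \<comment> \<open>The product \<open>\<kappa> * \<sigma>\<close> is \<open>sing_val 1 Ys\<close>;
    this trades \<open>T\<close> for the quantities in the thresholds of the first region.\<close>
  have "T \<le> \<kappa> * \<sigma>"
    using spectral_norm_le_sing_val_1 \<open>0 < \<sigma>\<close> by (simp add: \<kappa> cond_num_def \<sigma> T_def)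
  then have "0 < \<kappa>"
    using \<open>0 < T\<close> \<open>0 < \<sigma>\<close> by (metis less_le_trans zero_less_mult_pos2)
  define A where "A = \<alpha> * \<mu> * \<sigma>^3 / (4 * \<kappa>)"

  \<comment> \<open>Unsimplified lower bounds in the three regions\<close>
  have sharp1: "lhs Y > A - 2 * (\<delta> * (1 + \<gamma>) * S + N) * (\<beta> * T)"
    if "Y \<in> region1 Xs Ys \<mu> \<alpha> \<beta> \<gamma>" for Y
  proof -
    have Y: "norm (lifted_grad (obj_H Xs) Y) > A" "spectral_norm Y \<le> \<beta> * T" "x Y \<le> \<gamma> * S"
      using that by (auto simp: region1_def A_def \<sigma> \<kappa> T_def x_def S)
    have "\<delta> * (x Y + S) \<le> \<delta> * (1 + \<gamma>) * S"
      using mult_left_mono[of "x Y + S" "(1 + \<gamma>) * S" \<delta>] Y(3) \<delta>(1) by (simp add: algebra_simps)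
    then have "2 * (\<delta> * (x Y + S) + N) \<le> 2 * (\<delta> * (1 + \<gamma>) * S + N)"
      by simp
    from this Y(2) have "2 * (\<delta> * (x Y + S) + N) * spectral_norm Y \<le> 2 * (\<delta> * (1 + \<gamma>) * S + N) * (\<beta> * T)"
      by (rule mult_mono)
        (use \<delta>(1) \<open>0 < S\<close> N0 spectral_norm_nonneg[of Y] params(4) in auto)
    with ge_H[of Y] Y(1) show ?thesis
      by linarith
  qed

  \<comment> \<open>The special case for \<open>region2\<close> does not follow from the general bound, whose error term grows
    with \<open>spectral_norm Y\<close>; it needs this factored form.\<close>
  have sharp2: "lhs Y \<ge> 2 * y * (y\<^sup>2 - T\<^sup>2 - \<delta> * (1 + \<gamma>) * S - N)" "\<beta> * T < y" "0 < y"
    if "Y \<in> region2 Ys \<beta> \<gamma>" and "y = spectral_norm Y" for Y y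
  proof -
    have Y: "\<beta> * T < y" "x Y \<le> \<gamma> * S"
      using that by (auto simp: region2_def T_def x_def S)
    then show "\<beta> * T < y" "0 < y"
      using params \<open>0 < T\<close> by (auto intro: le_less_trans[rotated])
    have "\<delta> * (x Y + S) \<le> \<delta> * (1 + \<gamma>) * S"
      using mult_left_mono[of "x Y + S" "(1 + \<gamma>) * S" \<delta>] Y(2) \<delta>(1) by (simp add: algebra_simps)
    then have "2 * y * (y\<^sup>2 - T\<^sup>2 - \<delta> * (1 + \<gamma>) * S - N) \<le> 2 * y * (y\<^sup>2 - T\<^sup>2 - (\<delta> * (x Y + S) + N))"
      using \<open>0 < y\<close> by (intro mult_left_mono) auto
    with ge_sp[of Y] show "lhs Y \<ge> 2 * y * (y\<^sup>2 - T\<^sup>2 - \<delta> * (1 + \<gamma>) * S - N)"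
      unfolding that(2) by linarith
  qed

  \<comment> \<open>Lower bound for \<open>x Y / norm Y\<close> in the third region: the ratio is at
    least \<open>sqrt (x Y) / sqrt CARD('r)\<close>, and \<open>x Y\<close> exceeds
    \<open>\<gamma> * S\<close>.\<close>
  define c where "c = sqrt (\<gamma> * S) / sqrt CARD('r)"
  have sharp3: "2 * c * ((\<gamma> - 1) * S - \<delta> * (\<gamma> + 1) * S - N) \<le> lhs Y"
    "0 < c \<Longrightarrow> 2 * c * ((\<gamma> - 1) * S - \<delta> * (\<gamma> + 1) * S - N) < lhs Y"
    if "Y \<in> region3 Ys \<gamma>" for Y
  proof -
    have Y: "\<gamma> * S < x Y"
      using that by (auto simp: region3_def x_def S)
    moreover have "0 \<le> \<gamma> * S"
      using params \<open>0 < S\<close> by simp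
    ultimately have "0 < x Y"
      by linarith
    then have "Y \<noteq> 0"
      by (auto simp: x_def)
    have "(norm Y)\<^sup>2 \<le> (sqrt CARD('r) * sqrt (x Y))\<^sup>2"
      using norm_sq_le_rank_norm_gram[of Y] x0[of Y] by (simp add: x_def power_mult_distrib)
    then have "norm Y \<le> sqrt CARD('r) * sqrt (x Y)"
      by (rule power2_le_imp_le) (simp add: x0)
    then have "sqrt (x Y) * norm Y \<le> sqrt (x Y) * (sqrt CARD('r) * sqrt (x Y))"
      by (rule mult_left_mono) (simp add: x0)
    then have "sqrt (x Y) * norm Y \<le> x Y * sqrt CARD('r)"
      using x0[of Y] by (simp add: ac_simps flip: mult.assoc)
    then have pq: "sqrt (x Y) / sqrt CARD('r) \<le> x Y / norm Y"
      using \<open>Y \<noteq> 0\<close> by (simp add: field_simps)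
    have cp: "0 \<le> c" "c \<le> sqrt (x Y) / sqrt CARD('r)" "0 < sqrt (x Y) / sqrt CARD('r)"
      using Y \<open>0 < x Y\<close> \<open>0 \<le> \<gamma> * S\<close> by (auto simp: c_def intro!: divide_right_mono)
    \<comment> \<open>Here \<delta> < 1 preserves the strict inequality that defines the
      region.\<close>
    have "(1 - \<delta>) * (\<gamma> * S) < (1 - \<delta>) * x Y"
      using Y \<delta>(2) by (intro mult_strict_left_mono) auto
    then have "(\<gamma> - 1) * S - \<delta> * (\<gamma> + 1) * S - N < (1 - \<delta>) * x Y - (1 + \<delta>) * S - N"
      by (simp add: algebra_simps)
    from mult_less_threshold[OF cp(1,2) pq cp(3) this ge_F[OF \<open>Y \<noteq> 0\<close>] lhs0]
    show "2 * c * ((\<gamma> - 1) * S - \<delta> * (\<gamma> + 1) * S - N) \<le> lhs Y"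
      "0 < c \<Longrightarrow> 2 * c * ((\<gamma> - 1) * S - \<delta> * (\<gamma> + 1) * S - N) < lhs Y"
      by auto
  qed
  have c_S: "\<gamma> powr (1/2) * S powr (1/2) / sqrt CARD('r) = c"
    and c_S3: "\<gamma> powr (1/2) * S powr (3/2) / sqrt CARD('r) = c * S"
  proof -
    show c1: "\<gamma> powr (1/2) * S powr (1/2) / sqrt CARD('r) = c"
      using params \<open>0 < S\<close> by (simp add: c_def powr_half_sqrt real_sqrt_mult)
    have "S powr (3/2) = S powr (1/2) * S"
      using \<open>0 < S\<close> powr_add[of S "1/2" 1] by simp
    then show "\<gamma> powr (1/2) * S powr (3/2) / sqrt CARD('r) = c * S"
      by (simp flip: c1)
  qed

  have part2: "lhs Y \<ge> 2 * (\<beta>^3 - \<beta>) * T^3 - (2 * \<delta> * (1 + \<gamma>) * y * S + 2 * y * N)"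
    "0 < \<beta> \<or> 0 < \<delta> \<or> 0 < N \<Longrightarrow>
      lhs Y > 2 * (\<beta>^3 - \<beta>) * T^3 - (2 * \<delta> * (1 + \<gamma>) * y * S + 2 * y * N)"
    if Y: "Y \<in> region2 Ys \<beta> \<gamma>" and y: "y = spectral_norm Y" for Y y
  proof -
    note s = sharp2[OF Y y]
    have nonneg: "0 \<le> \<delta> * (1 + \<gamma>) * y * S" "0 \<le> y * N"
      using \<delta>(1) params s(3) \<open>0 < S\<close> N0 by auto
    have factor: "(\<beta>^3 - \<beta>) * T^3 = \<beta> * (\<beta>\<^sup>2 - 1) * T^3"
      by (simp add: power2_eq_square power3_eq_cube algebra_simps)
    have "2 * (\<beta>^3 - \<beta>) * T^3 - (2 * \<delta> * (1 + \<gamma>) * y * S + 2 * y * N) \<le> lhs Y \<and>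
      (0 < \<beta> \<or> 0 < \<delta> \<or> 0 < N \<longrightarrow>
        2 * (\<beta>^3 - \<beta>) * T^3 - (2 * \<delta> * (1 + \<gamma>) * y * S + 2 * y * N) < lhs Y)"
    \<comment> \<open>For \<beta> < 1 the leading term is at most 0, so a nonnegative gradient norm
      suffices, with strictness as soon as one term of the right-hand side is negative. Otherwise
      \<open>y * (y\<^sup>2 - T\<^sup>2)\<close> is compared with its value at
      \<open>\<beta> * T\<close>.\<close>
    proof (cases "\<beta> < 1")
      case True
      then have "\<beta>\<^sup>2 < 1"
        using params by (simp add: power_less_one_iff abs_square_less_1)
      then have "\<beta> * (\<beta>\<^sup>2 - 1) \<le> 0" "0 < \<beta> \<Longrightarrow> \<beta> * (\<beta>\<^sup>2 - 1) < 0"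
        using params by (simp_all add: mult_nonneg_nonpos mult_pos_neg)
      then have le: "(\<beta>^3 - \<beta>) * T^3 \<le> 0" and lt: "0 < \<beta> \<Longrightarrow> (\<beta>^3 - \<beta>) * T^3 < 0"
        using \<open>0 < T\<close> unfolding factor by (simp_all add: mult_nonpos_nonneg mult_neg_pos)
      have \<delta>_pos: "0 < \<delta> * (1 + \<gamma>) * y * S" if "0 < \<delta>"
        using that params s(3) \<open>0 < S\<close> by simp
      have N_pos: "0 < y * N" if "0 < N"
        using that s(3) by simp
      have rhs: "2 * (\<beta>^3 - \<beta>) * T^3 - (2 * \<delta> * (1 + \<gamma>) * y * S + 2 * y * N)
          = 2 * ((\<beta>^3 - \<beta>) * T^3 - \<delta> * (1 + \<gamma>) * y * S - y * N)"
        by (simp add: algebra_simps)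
      have "(\<beta>^3 - \<beta>) * T^3 - \<delta> * (1 + \<gamma>) * y * S - y * N < 0" if "0 < \<beta> \<or> 0 < \<delta> \<or> 0 < N"
        using that
      proof (elim disjE)
        show ?thesis if "0 < \<beta>"
          using lt[OF that] nonneg by linarith
        show ?thesis if "0 < \<delta>"
          using \<delta>_pos[OF that] le nonneg by linarith
        show ?thesis if "0 < N"
          using N_pos[OF that] le nonneg by linarith
      qed
      moreover have "(\<beta>^3 - \<beta>) * T^3 - \<delta> * (1 + \<gamma>) * y * S - y * N \<le> 0"
        using le nonneg by linarith
      ultimately show ?thesis
        unfolding rhs using lhs0[of Y] by (auto intro: order_trans less_le_trans)
    next
      case False
      have "T\<^sup>2 \<le> (\<beta> * T)\<^sup>2" "(\<beta> * T)\<^sup>2 < y\<^sup>2"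
        using False \<open>0 < T\<close> s(2) by (auto intro!: power_mono power_strict_mono)
      then have "(\<beta> * T) * ((\<beta> * T)\<^sup>2 - T\<^sup>2) \<le> y * ((\<beta> * T)\<^sup>2 - T\<^sup>2)"
        "y * ((\<beta> * T)\<^sup>2 - T\<^sup>2) < y * (y\<^sup>2 - T\<^sup>2)"
        using s(2,3) by (auto intro!: mult_right_mono mult_strict_left_mono)
      moreover have "(\<beta> * T) * ((\<beta> * T)\<^sup>2 - T\<^sup>2) = (\<beta>^3 - \<beta>) * T^3"
        by (simp add: power2_eq_square power3_eq_cube algebra_simps)
      moreover have "2 * y * (y\<^sup>2 - T\<^sup>2 - \<delta> * (1 + \<gamma>) * S - N)
          = 2 * (y * (y\<^sup>2 - T\<^sup>2)) - (2 * \<delta> * (1 + \<gamma>) * y * S + 2 * y * N)"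
        by (simp add: algebra_simps)
      ultimately show ?thesis
        using s(1) by linarith
    qed
    then show "lhs Y \<ge> 2 * (\<beta>^3 - \<beta>) * T^3 - (2 * \<delta> * (1 + \<gamma>) * y * S + 2 * y * N)"
      "0 < \<beta> \<or> 0 < \<delta> \<or> 0 < N \<Longrightarrow>
        lhs Y > 2 * (\<beta>^3 - \<beta>) * T^3 - (2 * \<delta> * (1 + \<gamma>) * y * S + 2 * y * N)"
      by auto
  qed

  \<comment> \<open>Positive lower bounds when \<delta> and \<open>N\<close> lie below their
    thresholds\<close>
  have special:
    "(\<forall>Y \<in> region1 Xs Ys \<mu> \<alpha> \<beta> \<gamma>. lhs Y > \<alpha> * \<mu> * \<sigma>^3 / (8 * \<kappa>)) \<and>
     (\<forall>Y \<in> region2 Ys \<beta> \<gamma>. lhs Y > (\<beta>^3 - \<beta>) * T^3) \<and>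
     (\<forall>Y \<in> region3 Ys \<gamma>. lhs Y > (\<gamma> - 1) * (c * S)) \<and>
     (0 < \<alpha> \<and> 0 < \<mu> \<longrightarrow> \<alpha> * \<mu> * \<sigma>^3 / (8 * \<kappa>) > 0) \<and>
     (\<beta>^3 - \<beta>) * T^3 > 0 \<and> (\<gamma> - 1) * (c * S) > 0"
    if \<beta>: "\<beta> > 1" and \<gamma>: "\<gamma> > 1" and "\<delta> \<le> \<delta>min" and "N \<le> \<Psi>"
  proof -
    have d: "\<delta> \<le> \<alpha> * \<mu> / (32 * \<kappa>\<^sup>2 * \<beta> * (1 + \<gamma>)) * (\<sigma>\<^sup>2 / S)"
        "\<delta> \<le> (\<beta>\<^sup>2 - 1) / (4 * (1 + \<gamma>)) * (T\<^sup>2 / S)" "\<delta> \<le> (\<gamma> - 1) / (4 * (\<gamma> + 1))"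
      and n: "N \<le> \<alpha> * \<mu> / (32 * \<kappa>\<^sup>2 * \<beta>) * \<sigma>\<^sup>2" "N \<le> (\<beta>\<^sup>2 - 1) / 4 * T\<^sup>2" "N \<le> (\<gamma> - 1) / 4 * S"
      using that(3,4) by (simp_all add: \<delta>min \<Psi> T_def)
    have "0 < c"
      using \<gamma> \<open>0 < S\<close> by (simp add: c_def)
    have "\<beta> < \<beta>^3"
      using \<beta> power_strict_increasing[of 1 3 \<beta>] by simp
    \<comment> \<open>Common bound for the two error terms after multiplication by \<beta>. The
      constant 32 is chosen so that together they cost
      \<open>4 * e * \<kappa> * \<sigma> = A / 2\<close>.\<close>
    define e where "e = \<alpha> * \<mu> * \<sigma>\<^sup>2 / (32 * \<kappa>\<^sup>2)"
    have cancel: "a / (32 * k * b * g) * (q / w) * (g * w * b) = a * q / (32 * k)"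
      if "b \<noteq> 0" "g \<noteq> 0" "w \<noteq> 0" for a b g k q w :: real
      using that by simp
    have "\<delta> * ((1 + \<gamma>) * S * \<beta>)
        \<le> \<alpha> * \<mu> / (32 * \<kappa>\<^sup>2 * \<beta> * (1 + \<gamma>)) * (\<sigma>\<^sup>2 / S) * ((1 + \<gamma>) * S * \<beta>)"
      using d(1) \<beta> \<gamma> \<open>0 < S\<close> by (intro mult_right_mono) auto
    also have "\<dots> = e"
      unfolding e_def using \<beta> \<gamma> \<open>0 < S\<close> by (intro cancel) auto
    finally have "\<delta> * (1 + \<gamma>) * S * \<beta> \<le> e"
      by (simp add: mult.assoc)
    moreover have "N * \<beta> \<le> e"
      using n(1) \<beta> \<open>0 < \<kappa>\<close> by (simp add: e_def field_simps)
    ultimately have "(\<delta> * (1 + \<gamma>) * S * \<beta> + N * \<beta>) * T \<le> (2 * e) * (\<kappa> * \<sigma>)"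
      using \<open>T \<le> \<kappa> * \<sigma>\<close> \<open>0 < T\<close> params by (intro mult_mono) (auto simp: e_def)
    also have "2 * ((2 * e) * (\<kappa> * \<sigma>)) = A / 2"
      using \<open>0 < \<kappa>\<close> by (simp add: e_def A_def field_simps power2_eq_square power3_eq_cube)
    finally have "2 * (\<delta> * (1 + \<gamma>) * S + N) * (\<beta> * T) \<le> A / 2"
      by (simp add: algebra_simps)
    then have 1: "lhs Y > \<alpha> * \<mu> * \<sigma>^3 / (8 * \<kappa>)" if "Y \<in> region1 Xs Ys \<mu> \<alpha> \<beta> \<gamma>" for Y
      using sharp1[OF that] by (simp add: A_def)
    have 2: "lhs Y > (\<beta>^3 - \<beta>) * T^3" if Y: "Y \<in> region2 Ys \<beta> \<gamma>" for Y
    proof -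
      define y where "y = spectral_norm Y"
      note s = sharp2[OF Y y_def]
      have "(\<beta> * T)\<^sup>2 < y\<^sup>2"
        using s(2) \<beta> \<open>0 < T\<close> by (intro power_strict_mono) auto
      moreover have "\<delta> * (1 + \<gamma>) * S \<le> (\<beta>\<^sup>2 - 1) / 4 * T\<^sup>2"
      proof -
        have cancel: "a / (4 * g) * (q / w) * (g * w) = a / 4 * q" if "g \<noteq> 0" "w \<noteq> 0" for a g q w :: real
          using that by simp
        have "\<delta> * ((1 + \<gamma>) * S) \<le> (\<beta>\<^sup>2 - 1) / (4 * (1 + \<gamma>)) * (T\<^sup>2 / S) * ((1 + \<gamma>) * S)"
          using d(2) \<gamma> \<open>0 < S\<close> by (intro mult_right_mono) auto
        also have "\<dots> = (\<beta>\<^sup>2 - 1) / 4 * T\<^sup>2"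
          using \<gamma> \<open>0 < S\<close> by (intro cancel) auto
        finally show ?thesis
          by (simp add: mult.assoc)
      qed
      moreover have quarter: "(\<beta>\<^sup>2 - 1) / 4 * T\<^sup>2 = ((\<beta> * T)\<^sup>2 - T\<^sup>2) / 4"
        by (simp add: power_mult_distrib algebra_simps)
      \<comment> \<open>Two errors of at most a quarter of the gap leave more than half of
        it.\<close>
      moreover have "(u - w) / 2 < v - w - p - q" if "u < v" "p \<le> (u - w) / 4" "q \<le> (u - w) / 4"
        for u v w p q :: real
        using that by (simp add: field_simps)
      ultimately have bracket: "((\<beta> * T)\<^sup>2 - T\<^sup>2) / 2 < y\<^sup>2 - T\<^sup>2 - \<delta> * (1 + \<gamma>) * S - N"
        using n(2) unfolding quarter by blast
      have "T\<^sup>2 \<le> (\<beta> * T)\<^sup>2"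
        using \<beta> \<open>0 < T\<close> by (intro power_mono) auto
      have "(\<beta>^3 - \<beta>) * T^3 = 2 * (\<beta> * T) * (((\<beta> * T)\<^sup>2 - T\<^sup>2) / 2)"
        by (simp add: power2_eq_square power3_eq_cube algebra_simps)
      also have "\<dots> \<le> 2 * y * (((\<beta> * T)\<^sup>2 - T\<^sup>2) / 2)"
        using s(2) \<open>T\<^sup>2 \<le> (\<beta> * T)\<^sup>2\<close> by (intro mult_right_mono) auto
      also have "\<dots> < 2 * y * (y\<^sup>2 - T\<^sup>2 - \<delta> * (1 + \<gamma>) * S - N)"
        using s(3) bracket by (intro mult_strict_left_mono) auto
      finally show ?thesis
        using s(1) by linarith
    qed
    have 3: "lhs Y > (\<gamma> - 1) * (c * S)" if Y: "Y \<in> region3 Ys \<gamma>" for Y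
    proof -
      have "\<delta> * (\<gamma> + 1) \<le> (\<gamma> - 1) / 4"
        using d(3) \<gamma> by (simp add: field_simps)
      \<comment> \<open>Again each error takes at most a quarter of the main term, here
        \<open>(\<gamma> - 1) * S\<close>.\<close>
      then have "\<delta> * (\<gamma> + 1) * S \<le> (\<gamma> - 1) / 4 * S"
        using \<open>0 < S\<close> by (intro mult_right_mono) auto
      then have "(\<gamma> - 1) * S / 2 \<le> (\<gamma> - 1) * S - \<delta> * (\<gamma> + 1) * S - N"
        using n(3) by linarith
      then have "2 * c * ((\<gamma> - 1) * S / 2) \<le> 2 * c * ((\<gamma> - 1) * S - \<delta> * (\<gamma> + 1) * S - N)"
        using \<open>0 < c\<close> by (intro mult_left_mono) auto
      also have "\<dots> < lhs Y"
        using sharp3(2)[OF Y \<open>0 < c\<close>] .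
      also have "2 * c * ((\<gamma> - 1) * S / 2) = (\<gamma> - 1) * (c * S)"
        by simp
      finally show ?thesis .
    qed
    show ?thesis
      using 1 2 3 \<open>0 < c\<close> \<open>0 < S\<close> \<open>0 < T\<close> \<open>0 < \<sigma>\<close> \<open>0 < \<kappa>\<close> \<open>\<beta> < \<beta>^3\<close> \<gamma> by auto
  qed

  \<comment> \<open>Translation into the stated powers and assembly\<close>
  have part3: "(2 * (\<gamma> - 1) - 2 * \<delta> * (\<gamma> + 1)) * \<gamma> powr (1/2) * S powr (3/2) / sqrt (real CARD('r))
      - 2 * \<gamma> powr (1/2) * S powr (1/2) * N / sqrt (real CARD('r))
    = 2 * c * ((\<gamma> - 1) * S - \<delta> * (\<gamma> + 1) * S - N)"
  proof -
    have "(2 * (\<gamma> - 1) - 2 * \<delta> * (\<gamma> + 1)) * \<gamma> powr (1/2) * S powr (3/2) / sqrt (real CARD('r))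
        = (2 * (\<gamma> - 1) - 2 * \<delta> * (\<gamma> + 1)) * (c * S)"
      by (simp flip: c_S3)
    moreover have "2 * \<gamma> powr (1/2) * S powr (1/2) * N / sqrt (real CARD('r)) = 2 * c * N"
      by (simp flip: c_S)
    ultimately show ?thesis
      by (simp add: algebra_simps)
  qed
  have special3: "(\<gamma> - 1) * \<gamma> powr (1/2) * S powr (3/2) / sqrt (real CARD('r)) = (\<gamma> - 1) * (c * S)"
    by (simp flip: c_S3)
  have c_pos: "0 < c" if "0 < \<gamma>"
    using that \<open>0 < S\<close> by (simp add: c_def)
  have part1: "lhs Y \<ge> A - (2 * \<delta> * \<beta> * (1 + \<gamma>) * T * S + 2 * \<beta> * T * N)"
    if "Y \<in> region1 Xs Ys \<mu> \<alpha> \<beta> \<gamma>" for Y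
    using sharp1[OF that] by (simp add: algebra_simps)
  show ?thesis
    unfolding Let_def part3 special3 lhs_def[symmetric] T_def[symmetric] A_def[symmetric]
    using part1 part2 sharp3 c_pos special by blast
qed

end
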